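(* Let $n\geq 3$ and let $M^n$ be a connected smooth $n$-manifold. There does not exist a complete flat front $f:M^n\to\mathbb{R}^{n+1}$ whose singular set $S(f)$ is non-empty.
   Context: Let $M^n$ be a connected smooth $n$-manifold and $f:M^n\to\mathbb{R}^{n+1}$ a smooth map; $S^n$ is the unit sphere in $\mathbb{R}^{n+1}$ and "$\cdot$" the Euclidean inner product. A point $p$ is a singular point of $f$ if $f$ is not an immersion at $p$; $S(f)$ denotes the set of singular points. $f$ is a frontal if every $p\in M^n$ has a neighborhood $U$ with a smooth map $\nu:U\to S^n$ (a unit normal) such that $df_q(v)\cdot\nu(q)=0$ for all $q\in U$, $v\in T_qM^n$. A frontal is a (wave) front if moreover $(f,\nu):U\to\mathbb{R}^{n+1}\times S^n$ is an immersion. The induced metric is $ds^2=df\cdot df$. A front $f$ is complete if there exists a symmetric covariant $(0,2)$-tensor $T$ on $M^n$ with compact support such that $ds^2+T$ is a complete Riemannian metric on $M^n$. A frontal $f$ with unit normal $\nu$ is flat if the connection $D$ on the rank-$n$ bundle $\mathcal{E}_f=\{\xi\in f^*\mathbb{R}^{n+1}: \xi\cdot\nu=0\}$, given by taking the tangential (i.e. $\nu^\perp$) part of the ordinary derivative of $\mathbb{R}^{n+1}$-valued sections, has vanishing curvature $R^D(X,Y)\xi=D_XD_Y\xi-D_YD_X\xi-D_{[X,Y]}\xi=0$ for all vector fields $X,Y$ and sections $\xi$; this is equivalent to $\operatorname{rank}(d\nu)\leq 1$ everywhere on $M^n$. *)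

theory Defs
  imports "HOL-Analysis.Analysis"
begin

fun iter_deriv :: "'a::real_normed_vector list \<Rightarrow> ('a \<Rightarrow> 'b::real_normed_vector) \<Rightarrow> 'a \<Rightarrow> 'b" where
  "iter_deriv [] g = g"
| "iter_deriv (v # vs) g = (\<lambda>x. frechet_derivative (iter_deriv vs g) (at x) v)"

definition smooth_on :: "'a::real_normed_vector set \<Rightarrow> ('a \<Rightarrow> 'b::real_normed_vector) \<Rightarrow> bool" where
  "smooth_on S g \<longleftrightarrow> open S \<and> (\<forall>vs. \<forall>x\<in>S. iter_deriv vs g differentiable (at x))"

text \<open>Charts and smooth atlases of an n-manifold (n = CARD('n)); the point set of the
  manifold is the type 'm with its topology.\<close>

type_synonym ('m, 'n) chart = "'m set \<times> ('m \<Rightarrow> real^'n)"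

definition chart_inv :: "('m, 'n) chart \<Rightarrow> real^'n \<Rightarrow> 'm" where
  "chart_inv c = inv_into (fst c) (snd c)"

definition cdom :: "('m, 'n) chart \<Rightarrow> (real^'n) set" where
  "cdom c = snd c ` fst c"

definition is_chart :: "('m::topological_space, 'n::finite) chart \<Rightarrow> bool" where
  "is_chart c \<longleftrightarrow> open (fst c) \<and> open (cdom c) \<and> inj_on (snd c) (fst c)
     \<and> continuous_on (fst c) (snd c) \<and> continuous_on (cdom c) (chart_inv c)"

definition smooth_atlas :: "('m::topological_space, 'n::finite) chart set \<Rightarrow> bool" where
  "smooth_atlas A \<longleftrightarrow> (\<forall>c\<in>A. is_chart c) \<and> (\<Union>(fst ` A) = UNIV)
     \<and> (\<forall>c1\<in>A. \<forall>c2\<in>A. smooth_on (snd c1 ` (fst c1 \<inter> fst c2)) (snd c2 \<circ> chart_inv c1))"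

definition smooth_map :: "('m, 'n::finite) chart set \<Rightarrow> 'm set \<Rightarrow> ('m \<Rightarrow> 'b::real_normed_vector) \<Rightarrow> bool" where
  "smooth_map A U g \<longleftrightarrow> (\<forall>c\<in>A. smooth_on (snd c ` (U \<inter> fst c)) (g \<circ> chart_inv c))"

definition cdiff :: "('m, 'n::finite) chart \<Rightarrow> ('m \<Rightarrow> 'b::real_normed_vector) \<Rightarrow> real^'n \<Rightarrow> real^'n \<Rightarrow> 'b" where
  "cdiff c g x = frechet_derivative (g \<circ> chart_inv c) (at x)"

definition immersion_at :: "('m, 'n::finite) chart set \<Rightarrow> ('m \<Rightarrow> 'b::real_normed_vector) \<Rightarrow> 'm \<Rightarrow> bool" where
  "immersion_at A g p \<longleftrightarrow> (\<forall>c\<in>A. p \<in> fst c \<longrightarrow> inj (cdiff c g (snd c p)))"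

definition singular_set :: "('m, 'n::finite) chart set \<Rightarrow> ('m \<Rightarrow> 'b::real_normed_vector) \<Rightarrow> 'm set" where
  "singular_set A g = {p. \<not> immersion_at A g p}"

definition unit_normal :: "('m::topological_space, 'n::finite) chart set \<Rightarrow> ('m \<Rightarrow> 'b::euclidean_space) \<Rightarrow> 'm set \<Rightarrow> ('m \<Rightarrow> 'b) \<Rightarrow> bool" where
  "unit_normal A f U \<nu> \<longleftrightarrow> open U \<and> smooth_map A U \<nu> \<and> (\<forall>q\<in>U. norm (\<nu> q) = 1)
     \<and> (\<forall>c\<in>A. \<forall>q\<in>U \<inter> fst c. \<forall>v. cdiff c f (snd c q) v \<bullet> \<nu> q = 0)"

definition frontal :: "('m::topological_space, 'n::finite) chart set \<Rightarrow> ('m \<Rightarrow> 'b::euclidean_space) \<Rightarrow> bool" where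
  "frontal A f \<longleftrightarrow> (\<forall>p. \<exists>U \<nu>. p \<in> U \<and> unit_normal A f U \<nu>)"

definition front_on :: "('m::topological_space, 'n::finite) chart set \<Rightarrow> ('m \<Rightarrow> 'b::euclidean_space) \<Rightarrow> 'm set \<Rightarrow> ('m \<Rightarrow> 'b) \<Rightarrow> bool" where
  "front_on A f U \<nu> \<longleftrightarrow> unit_normal A f U \<nu> \<and> (\<forall>q\<in>U. immersion_at A (\<lambda>q. (f q, \<nu> q)) q)"

definition front :: "('m::topological_space, 'n::finite) chart set \<Rightarrow> ('m \<Rightarrow> 'b::euclidean_space) \<Rightarrow> bool" where
  "front A f \<longleftrightarrow> (\<forall>p. \<exists>U \<nu>. p \<in> U \<and> front_on A f U \<nu>)"

text \<open>The connection D on E_f written in local coordinates: N is the unit normal in the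
  chart, X a vector field (in coordinates), xi a section of E_f (an R^(n+1)-valued map
  orthogonal to N).  D_X xi = tangential part of d xi(X).\<close>
definition Dcov :: "(real^'n \<Rightarrow> 'b::euclidean_space) \<Rightarrow> (real^'n \<Rightarrow> real^'n) \<Rightarrow> (real^'n \<Rightarrow> 'b) \<Rightarrow> real^'n \<Rightarrow> 'b" where
  "Dcov N X \<xi> = (\<lambda>x. frechet_derivative \<xi> (at x) (X x)
                     - (frechet_derivative \<xi> (at x) (X x) \<bullet> N x) *\<^sub>R N x)"

definition vf_bracket :: "(real^'n \<Rightarrow> real^'n) \<Rightarrow> (real^'n \<Rightarrow> real^'n) \<Rightarrow> real^'n \<Rightarrow> real^'n" where
  "vf_bracket X Y = (\<lambda>x. frechet_derivative Y (at x) (X x) - frechet_derivative X (at x) (Y x))"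

definition curvD :: "(real^'n \<Rightarrow> 'b::euclidean_space) \<Rightarrow> (real^'n \<Rightarrow> real^'n) \<Rightarrow> (real^'n \<Rightarrow> real^'n) \<Rightarrow> (real^'n \<Rightarrow> 'b) \<Rightarrow> real^'n \<Rightarrow> 'b" where
  "curvD N X Y \<xi> x = Dcov N X (Dcov N Y \<xi>) x - Dcov N Y (Dcov N X \<xi>) x - Dcov N (vf_bracket X Y) \<xi> x"

definition flat_on :: "('m, 'n::finite) chart set \<Rightarrow> 'm set \<Rightarrow> ('m \<Rightarrow> 'b::euclidean_space) \<Rightarrow> bool" where
  "flat_on A U \<nu> \<longleftrightarrow> (\<forall>c\<in>A. \<forall>\<xi> X Y.
      smooth_on (snd c ` (U \<inter> fst c)) \<xi> \<and> smooth_on (snd c ` (U \<inter> fst c)) X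
      \<and> smooth_on (snd c ` (U \<inter> fst c)) Y
      \<and> (\<forall>x\<in>snd c ` (U \<inter> fst c). \<xi> x \<bullet> \<nu> (chart_inv c x) = 0)
      \<longrightarrow> (\<forall>x\<in>snd c ` (U \<inter> fst c). curvD (\<nu> \<circ> chart_inv c) X Y \<xi> x = 0))"

definition flat_front :: "('m::topological_space, 'n::finite) chart set \<Rightarrow> ('m \<Rightarrow> 'b::euclidean_space) \<Rightarrow> bool" where
  "flat_front A f \<longleftrightarrow> (\<forall>p. \<exists>U \<nu>. p \<in> U \<and> front_on A f U \<nu> \<and> flat_on A U \<nu>)"

text \<open>Symmetric covariant (0,2)-tensor fields, represented by their local coordinate
  expressions G c x u v (chart c, coordinates x, tangent vectors u v in coordinates),
  smooth and compatible under changes of charts.\<close>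
type_synonym ('m, 'n) tensor2 = "('m, 'n) chart \<Rightarrow> real^'n \<Rightarrow> real^'n \<Rightarrow> real^'n \<Rightarrow> real"

definition sym_tensor :: "('m, 'n::finite) chart set \<Rightarrow> ('m, 'n) tensor2 \<Rightarrow> bool" where
  "sym_tensor A G \<longleftrightarrow> (\<forall>c\<in>A.
       (\<forall>x\<in>cdom c. bilinear (G c x) \<and> (\<forall>u v. G c x u v = G c x v u))
     \<and> (\<forall>u v. smooth_on (cdom c) (\<lambda>x. G c x u v)))
   \<and> (\<forall>c1\<in>A. \<forall>c2\<in>A. \<forall>p\<in>fst c1 \<inter> fst c2. \<forall>u v.
       G c1 (snd c1 p) u v = G c2 (snd c2 p) (cdiff c1 (snd c2) (snd c1 p) u) (cdiff c1 (snd c2) (snd c1 p) v))"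

definition tensor_support :: "('m::topological_space, 'n::finite) chart set \<Rightarrow> ('m, 'n) tensor2 \<Rightarrow> 'm set" where
  "tensor_support A G = closure {p. \<exists>c\<in>A. p \<in> fst c \<and> (\<exists>u v. G c (snd c p) u v \<noteq> 0)}"

definition induced_metric :: "('m \<Rightarrow> 'b::euclidean_space) \<Rightarrow> ('m, 'n::finite) tensor2" where
  "induced_metric f c x u v = cdiff c f x u \<bullet> cdiff c f x v"

definition riemannian :: "('m, 'n::finite) chart set \<Rightarrow> ('m, 'n) tensor2 \<Rightarrow> bool" where
  "riemannian A G \<longleftrightarrow> sym_tensor A G \<and> (\<forall>c\<in>A. \<forall>x\<in>cdom c. \<forall>u. u \<noteq> 0 \<longrightarrow> G c x u u > 0)"

definition curve_length :: "('m::topological_space, 'n::finite) chart set \<Rightarrow> ('m, 'n) tensor2 \<Rightarrow> 'm \<Rightarrow> 'm \<Rightarrow> real \<Rightarrow> bool" where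
  "curve_length A G p q L \<longleftrightarrow> (\<exists>(\<gamma>::real \<Rightarrow> 'm) (k::nat) (t::nat \<Rightarrow> real) (c::nat \<Rightarrow> ('m, 'n) chart) (D::nat \<Rightarrow> real \<Rightarrow> real^'n).
      continuous_on {0..1} \<gamma> \<and> \<gamma> 0 = p \<and> \<gamma> 1 = q \<and> t 0 = 0 \<and> t k = 1
    \<and> (\<forall>i<k. t i < t (Suc i) \<and> c i \<in> A \<and> \<gamma> ` {t i..t (Suc i)} \<subseteq> fst (c i)
         \<and> (\<forall>s\<in>{t i..t (Suc i)}. ((snd (c i) \<circ> \<gamma>) has_vector_derivative D i s) (at s within {t i..t (Suc i)}))
         \<and> continuous_on {t i..t (Suc i)} (D i))
    \<and> L = (\<Sum>i<k. integral {t i..t (Suc i)} (\<lambda>s. sqrt (G (c i) (snd (c i) (\<gamma> s)) (D i s) (D i s)))))"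

definition riem_dist :: "('m::topological_space, 'n::finite) chart set \<Rightarrow> ('m, 'n) tensor2 \<Rightarrow> 'm \<Rightarrow> 'm \<Rightarrow> real" where
  "riem_dist A G p q = Inf {L. curve_length A G p q L}"

definition complete_riemannian :: "('m::topological_space, 'n::finite) chart set \<Rightarrow> ('m, 'n) tensor2 \<Rightarrow> bool" where
  "complete_riemannian A G \<longleftrightarrow> riemannian A G \<and>
     (\<forall>x::nat \<Rightarrow> 'm. (\<forall>e>0. \<exists>N. \<forall>m\<ge>N. \<forall>n\<ge>N. riem_dist A G (x m) (x n) < e)
        \<longrightarrow> (\<exists>y. (\<lambda>j. riem_dist A G (x j) y) \<longlonglongrightarrow> 0))"

definition complete_front :: "('m::topological_space, 'n::finite) chart set \<Rightarrow> ('m \<Rightarrow> 'b::euclidean_space) \<Rightarrow> bool" where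
  "complete_front A f \<longleftrightarrow> front A f \<and> (\<exists>T. sym_tensor A T \<and> compact (tensor_support A T)
     \<and> complete_riemannian A (\<lambda>c x u v. induced_metric f c x u v + T c x u v))"

end

theory Submission
  imports Defs
begin

text \<open>
  Positivity of \<open>ds\<^sup>2 + T\<close> forces \<open>S(f)\<close> into the support of \<open>T\<close>, so the closed set
  \<open>S(f)\<close> is compact and \<open>|f|\<^sup>2\<close> attains its maximum over \<open>S(f)\<close> at some point \<open>p\<close>.
  This is contradicted by showing that \<open>f(p)\<close> is an interior point of a line segment
  contained in \<open>f(S(f))\<close>, along which \<open>|f|\<^sup>2\<close> is strictly convex.

  Near a singular point of a flat front the normal \<open>\<nu>\<close> has rank exactly one, so
  \<open>d\<nu> = a dg\<close> for a real function \<open>g\<close> without critical points. Along the level sets of \<open>g\<close>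
  (the leaves) \<open>\<nu>\<close> and \<open>a\<close> are constant, and \<open>f\<close> maps a leaf locally onto an open subset of an affine
  subspace of dimension \<open>n - 1\<close> orthogonal to \<open>\<nu>\<close> and \<open>a\<close>. Writing \<open>da = b dg\<close> and
  \<open>d(f \<bullet> a) = k dg\<close>, also \<open>b\<close> and \<open>k\<close> are constant on leaves, and
  \<open>df \<bullet> a = (k - f \<bullet> b) dg\<close>. Hence the singular points of a leaf are the zeros of the affine
  function \<open>k - f \<bullet> b\<close>; since \<open>n - 1 \<ge> 2\<close>, its zero set contains a line segment through each
  of its points.
\<close>

subsection \<open>Calculus of smooth functions\<close>

text \<open>In \<open>iter_deriv\<close> the head of the list is the last derivative taken. Here the
  derivative of \<open>g\<close> itself comes first, so closure properties follow by induction on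
  the order, with the function generalised.\<close>

primrec ktimes_differentiable_on ::
  "nat \<Rightarrow> 'a::real_normed_vector set \<Rightarrow> ('a \<Rightarrow> 'b::real_normed_vector) \<Rightarrow> bool" where
  "ktimes_differentiable_on 0 S g \<longleftrightarrow> (\<forall>x\<in>S. g differentiable (at x))"
| "ktimes_differentiable_on (Suc k) S g \<longleftrightarrow> (\<forall>x\<in>S. g differentiable (at x))
     \<and> (\<forall>v. ktimes_differentiable_on k S (\<lambda>x. frechet_derivative g (at x) v))"

lemma iter_deriv_snoc:
  "iter_deriv (vs @ [v]) g = iter_deriv vs (\<lambda>x. frechet_derivative g (at x) v)"
  by (induction vs) auto

lemma ktimes_differentiable_on_iff_iter_deriv:
  "ktimes_differentiable_on k S g \<longleftrightarrow>
    (\<forall>vs. length vs \<le> k \<longrightarrow> (\<forall>x\<in>S. iter_deriv vs g differentiable (at x)))"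
proof (induction k arbitrary: g)
  case 0
  then show ?case by simp
next
  case (Suc k)
  show ?case (is "?L \<longleftrightarrow> ?R")
  proof
    assume L: ?L
    show ?R
    proof (intro allI impI)
      fix vs :: "'a list" assume "length vs \<le> Suc k"
      then show "\<forall>x\<in>S. iter_deriv vs g differentiable (at x)"
        using L Suc.IH by (cases vs rule: rev_cases) (auto simp: iter_deriv_snoc)
    qed
  next
    assume R: ?R
    then have "\<forall>x\<in>S. iter_deriv [] g differentiable (at x)" by (metis le0 list.size(3))
    moreover have "ktimes_differentiable_on k S (\<lambda>x. frechet_derivative g (at x) v)" for v
      unfolding Suc.IH using R by (metis Suc_le_mono iter_deriv_snoc length_append_singleton)
    ultimately show ?L by simp
  qed
qed

lemma smooth_on_iff_ktimes:
  "smooth_on S g \<longleftrightarrow> open S \<and> (\<forall>k. ktimes_differentiable_on k S g)"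
  unfolding smooth_on_def ktimes_differentiable_on_iff_iter_deriv by blast

lemma ktimes_differentiable_on_Suc_imp:
  "ktimes_differentiable_on (Suc k) S g \<Longrightarrow> ktimes_differentiable_on k S g"
  unfolding ktimes_differentiable_on_iff_iter_deriv by (meson le_SucI)

lemma ktimes_differentiable_on_imp_differentiable:
  "ktimes_differentiable_on k S g \<Longrightarrow> x \<in> S \<Longrightarrow> g differentiable (at x)"
  by (cases k) auto

lemma frechet_derivative_eqI:
  "(g has_derivative D) (at x) \<Longrightarrow> frechet_derivative g (at x) = D"
  by (metis frechet_derivative_at)

lemma has_derivative_frechet:
  "g differentiable (at x) \<Longrightarrow> (g has_derivative frechet_derivative g (at x)) (at x)"
  by (simp add: frechet_derivative_works)

lemma differentiable_cong_open:
  assumes "open S" "x \<in> S" "\<And>y. y \<in> S \<Longrightarrow> g y = h y" "g differentiable (at x)"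
  shows "h differentiable (at x)"
  using has_derivative_transform_within_open[of g _ x UNIV S h] assms
  unfolding differentiable_def by metis

lemma frechet_derivative_cong_open:
  assumes "open S" "x \<in> S" "\<And>y. y \<in> S \<Longrightarrow> g y = h y"
  shows "frechet_derivative g (at x) = frechet_derivative h (at x)"
proof -
  have "(g has_derivative D) (at x) \<longleftrightarrow> (h has_derivative D) (at x)" for D
    using has_derivative_transform_within_open[of _ D x UNIV S] assms by metis
  then show ?thesis by (simp add: frechet_derivative_def)
qed

lemma ktimes_differentiable_on_cong:
  assumes "open S" "\<And>y. y \<in> S \<Longrightarrow> g y = h y" "ktimes_differentiable_on k S g"
  shows "ktimes_differentiable_on k S h"
  using assms(2,3)
proof (induction k arbitrary: g h)
  case 0
  then show ?case
    using differentiable_cong_open[OF assms(1)] by (metis ktimes_differentiable_on.simps(1))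
next
  case (Suc k)
  have "\<And>v y. y \<in> S \<Longrightarrow> frechet_derivative g (at y) v = frechet_derivative h (at y) v"
    using frechet_derivative_cong_open[OF assms(1)] Suc.prems(1) by metis
  moreover have "\<forall>x\<in>S. h differentiable (at x)"
    using differentiable_cong_open[OF assms(1)] Suc.prems
    by (metis ktimes_differentiable_on.simps(2))
  ultimately show ?case
    using Suc.IH Suc.prems(2) by (metis (no_types, lifting) ktimes_differentiable_on.simps(2))
qed

lemma ktimes_differentiable_on_add:
  assumes "open S" "ktimes_differentiable_on k S g" "ktimes_differentiable_on k S h"
  shows "ktimes_differentiable_on k S (\<lambda>x. g x + h x)"
  using assms(2,3)
proof (induction k arbitrary: g h)
  case 0
  then show ?case by simp
next
  case (Suc k)
  have "ktimes_differentiable_on k S (\<lambda>x. frechet_derivative (\<lambda>x. g x + h x) (at x) v)" for v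
  proof (rule ktimes_differentiable_on_cong[OF assms(1)])
    show "ktimes_differentiable_on k S
       (\<lambda>x. frechet_derivative g (at x) v + frechet_derivative h (at x) v)"
      using Suc by simp
    show "\<And>y. y \<in> S \<Longrightarrow> frechet_derivative g (at y) v + frechet_derivative h (at y) v
        = frechet_derivative (\<lambda>x. g x + h x) (at y) v"
      using Suc.prems by (subst frechet_derivative_eqI[OF has_derivative_add[OF
            has_derivative_frechet has_derivative_frechet]]) auto
  qed
  then show ?case using Suc.prems by simp
qed

text \<open>The product rule writes the derivative as a sum of products in which one factor is
  differentiated; each falls under the induction hypothesis. One proof serves multiplication,
  scaling and inner products.\<close>

lemma (in bounded_bilinear) ktimes_differentiable_on:
  assumes "open S" "ktimes_differentiable_on k S g" "ktimes_differentiable_on k S h"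
  shows "ktimes_differentiable_on k S (\<lambda>x. prod (g x) (h x))"
  using assms(2,3)
proof (induction k arbitrary: g h)
  case 0
  then show ?case
    by (auto intro!: differentiableI[OF FDERIV[OF has_derivative_frechet has_derivative_frechet]])
next
  case (Suc k)
  have der: "((\<lambda>x. prod (g x) (h x)) has_derivative
     (\<lambda>v. prod (g x) (frechet_derivative h (at x) v) + prod (frechet_derivative g (at x) v) (h x))) (at x)"
    if "x \<in> S" for x
    using that Suc.prems by (intro FDERIV has_derivative_frechet) auto
  have "ktimes_differentiable_on k S (\<lambda>x. frechet_derivative (\<lambda>x. prod (g x) (h x)) (at x) v)" for v
  proof (rule ktimes_differentiable_on_cong[OF assms(1)])
    show "ktimes_differentiable_on k S
       (\<lambda>x. prod (g x) (frechet_derivative h (at x) v) + prod (frechet_derivative g (at x) v) (h x))"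
      using Suc.prems Suc.prems[THEN ktimes_differentiable_on_Suc_imp]
      by (intro ktimes_differentiable_on_add assms(1) Suc.IH) simp_all
    show "\<And>x. x \<in> S \<Longrightarrow> prod (g x) (frechet_derivative h (at x) v) + prod (frechet_derivative g (at x) v) (h x)
        = frechet_derivative (\<lambda>x. prod (g x) (h x)) (at x) v"
      by (simp add: frechet_derivative_eqI[OF der])
  qed
  then show ?case using differentiableI[OF der] by auto
qed

lemma ktimes_differentiable_on_const: "ktimes_differentiable_on k S (\<lambda>x. c)"
  by (induction k arbitrary: c) (auto simp: frechet_derivative_const)

text \<open>The derivative of \<open>1/g\<close> is \<open>- (1/g) g' (1/g)\<close>, a product of
  \<open>g'\<close> with copies of \<open>1/g\<close>, whose regularity of one order less is the
  induction hypothesis.\<close>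

lemma ktimes_differentiable_on_inverse:
  fixes g :: "'a::real_normed_vector \<Rightarrow> real"
  assumes "open S" "ktimes_differentiable_on k S g" "\<And>x. x \<in> S \<Longrightarrow> g x \<noteq> 0"
  shows "ktimes_differentiable_on k S (\<lambda>x. inverse (g x))"
  using assms(2)
proof (induction k)
  case 0
  then show ?case using assms(3) by (simp add: differentiable_inverse)
next
  case (Suc k)
  have der: "((\<lambda>x. inverse (g x)) has_derivative
     (\<lambda>v. - (inverse (g x) * frechet_derivative g (at x) v * inverse (g x)))) (at x)"
    if "x \<in> S" for x
    using that Suc.prems by (intro Deriv.has_derivative_inverse assms(3) has_derivative_frechet) auto
  have inv: "ktimes_differentiable_on k S (\<lambda>x. inverse (g x))"
    using Suc ktimes_differentiable_on_Suc_imp by blast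
  have "ktimes_differentiable_on k S (\<lambda>x. frechet_derivative (\<lambda>x. inverse (g x)) (at x) v)" for v
  proof (rule ktimes_differentiable_on_cong[OF assms(1)])
    \<comment> \<open>The sign is written as a constant factor so that the product lemma covers
      it.\<close>
    show "ktimes_differentiable_on k S
       (\<lambda>x. (-1) * (inverse (g x) * frechet_derivative g (at x) v * inverse (g x)))"
      using Suc.prems inv
      by (intro bounded_bilinear.ktimes_differentiable_on[OF bounded_bilinear_mult] assms(1)
          ktimes_differentiable_on_const) auto
    show "\<And>x. x \<in> S \<Longrightarrow> (-1) * (inverse (g x) * frechet_derivative g (at x) v * inverse (g x))
        = frechet_derivative (\<lambda>x. inverse (g x)) (at x) v"
      by (simp add: frechet_derivative_eqI[OF der])
  qed
  then show ?case using differentiableI[OF der] by auto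
qed

section \<open>Closure properties of smooth functions\<close>

lemma smooth_on_open: "smooth_on S g \<Longrightarrow> open S"
  by (simp add: smooth_on_def)

lemma smooth_on_has_derivative:
  "smooth_on S g \<Longrightarrow> x \<in> S \<Longrightarrow> (g has_derivative frechet_derivative g (at x)) (at x)"
  unfolding smooth_on_iff_ktimes
  using has_derivative_frechet ktimes_differentiable_on_imp_differentiable by blast

lemma smooth_on_subset: "smooth_on S g \<Longrightarrow> open T \<Longrightarrow> T \<subseteq> S \<Longrightarrow> smooth_on T g"
  unfolding smooth_on_def by blast

lemma smooth_on_frechet_derivative:
  "smooth_on S g \<Longrightarrow> smooth_on S (\<lambda>x. frechet_derivative g (at x) v)"
  unfolding smooth_on_iff_ktimes using ktimes_differentiable_on.simps(2) by blast

lemma smooth_on_const: "open S \<Longrightarrow> smooth_on S (\<lambda>x. c)"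
  by (simp add: smooth_on_iff_ktimes ktimes_differentiable_on_const)

lemma smooth_on_add: "smooth_on S g \<Longrightarrow> smooth_on S h \<Longrightarrow> smooth_on S (\<lambda>x. g x + h x)"
  by (simp add: smooth_on_iff_ktimes ktimes_differentiable_on_add)

lemma smooth_on_inner:
  "smooth_on S g \<Longrightarrow> smooth_on S h \<Longrightarrow> smooth_on S (\<lambda>x. g x \<bullet> h x)"
  by (simp add: smooth_on_iff_ktimes bounded_bilinear.ktimes_differentiable_on[OF bounded_bilinear_inner])

lemma smooth_on_scaleR:
  "smooth_on S g \<Longrightarrow> smooth_on S h \<Longrightarrow> smooth_on S (\<lambda>x. g x *\<^sub>R h x)"
  by (simp add: smooth_on_iff_ktimes bounded_bilinear.ktimes_differentiable_on[OF bounded_bilinear_scaleR])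

lemma smooth_on_inverse:
  fixes g :: "'a::real_normed_vector \<Rightarrow> real"
  shows "smooth_on S g \<Longrightarrow> (\<And>x. x \<in> S \<Longrightarrow> g x \<noteq> 0) \<Longrightarrow> smooth_on S (\<lambda>x. inverse (g x))"
  by (simp add: smooth_on_iff_ktimes ktimes_differentiable_on_inverse)

lemma smooth_on_diff:
  assumes "smooth_on S g" "smooth_on S h" shows "smooth_on S (\<lambda>x. g x - h x)"
  using smooth_on_add[OF assms(1) smooth_on_scaleR[OF smooth_on_const[of _ "-1::real"] assms(2)]]
    smooth_on_open[OF assms(1)] by simp

lemma smooth_on_imp_continuous_on: "smooth_on S g \<Longrightarrow> continuous_on S g"
  by (meson continuous_at_imp_continuous_on has_derivative_continuous smooth_on_has_derivative)

lemma smooth_on_linear: "smooth_on S g \<Longrightarrow> x \<in> S \<Longrightarrow> linear (frechet_derivative g (at x))"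
  using has_derivative_linear smooth_on_has_derivative by blast

text \<open>Symmetry of second derivatives, by applying the mean value theorem twice to the
  second difference of the function.\<close>

lemma second_difference_mean_value:
  fixes g :: "'a::real_normed_vector \<Rightarrow> real"
  assumes sm: "smooth_on S g" and r: "0 < r"
    and inS: "\<And>s t. \<lbrakk>0 \<le> s; s \<le> r; 0 \<le> t; t \<le> r\<rbrakk> \<Longrightarrow> x + s *\<^sub>R u + t *\<^sub>R v \<in> S"
  obtains s t where "0 < s" "s < r" "0 < t" "t < r"
    "g (x + r *\<^sub>R u + r *\<^sub>R v) - g (x + r *\<^sub>R u) - g (x + r *\<^sub>R v) + g x
      = r * (r * frechet_derivative (\<lambda>y. frechet_derivative g (at y) u) (at (x + s *\<^sub>R u + t *\<^sub>R v)) v)"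
proof -
  let ?gu = "\<lambda>y. frechet_derivative g (at y) u"
  have lin1: "((\<lambda>s. g (x + s *\<^sub>R u + t *\<^sub>R v)) has_real_derivative ?gu (x + s *\<^sub>R u + t *\<^sub>R v)) (at s)"
    if "0 \<le> s" "s \<le> r" "0 \<le> t" "t \<le> r" for s t
  proof -
    have "((\<lambda>s. g (x + s *\<^sub>R u + t *\<^sub>R v)) has_derivative
        (\<lambda>h. frechet_derivative g (at (x + s *\<^sub>R u + t *\<^sub>R v)) (h *\<^sub>R u))) (at s)"
      by (rule has_derivative_compose[of "\<lambda>s. x + s *\<^sub>R u + t *\<^sub>R v" "\<lambda>h. h *\<^sub>R u" s UNIV g,
            OF _ smooth_on_has_derivative[OF sm inS[OF that]]]) (auto intro!: derivative_eq_intros)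
    then show ?thesis
      unfolding has_field_derivative_def
      using linear_cmul[OF smooth_on_linear[OF sm inS[OF that]]]
      by (elim has_derivative_eq_rhs) (simp add: fun_eq_iff mult.commute)
  qed
  have smu: "smooth_on S ?gu" by (rule smooth_on_frechet_derivative[OF sm])
  have lin2: "((\<lambda>t. ?gu (x + s *\<^sub>R u + t *\<^sub>R v)) has_real_derivative
       frechet_derivative ?gu (at (x + s *\<^sub>R u + t *\<^sub>R v)) v) (at t)"
    if "0 \<le> s" "s \<le> r" "0 \<le> t" "t \<le> r" for s t
  proof -
    have "((\<lambda>t. ?gu (x + s *\<^sub>R u + t *\<^sub>R v)) has_derivative
        (\<lambda>h. frechet_derivative ?gu (at (x + s *\<^sub>R u + t *\<^sub>R v)) (h *\<^sub>R v))) (at t)"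
      by (rule has_derivative_compose[of "\<lambda>t. x + s *\<^sub>R u + t *\<^sub>R v" "\<lambda>h. h *\<^sub>R v" t UNIV ?gu,
            OF _ smooth_on_has_derivative[OF smu inS[OF that]]]) (auto intro!: derivative_eq_intros)
    then show ?thesis
      unfolding has_field_derivative_def
      using linear_cmul[OF smooth_on_linear[OF smu inS[OF that]]]
      by (elim has_derivative_eq_rhs) (simp add: fun_eq_iff mult.commute)
  qed
  \<comment> \<open>The second difference is the increment over \<open>[0, r]\<close> of this
    difference in direction \<open>v\<close>. The term \<open>0 *\<^sub>R v\<close> is kept to match
    \<open>lin1\<close> at \<open>t = 0\<close>.\<close>
  let ?k = "\<lambda>s. g (x + s *\<^sub>R u + r *\<^sub>R v) - g (x + s *\<^sub>R u + 0 *\<^sub>R v)"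
  have "\<exists>s. 0 < s \<and> s < r \<and> ?k r - ?k 0 = (r - 0) *
      (?gu (x + s *\<^sub>R u + r *\<^sub>R v) - ?gu (x + s *\<^sub>R u + 0 *\<^sub>R v))"
    using r by (intro MVT2 DERIV_diff lin1) auto
  then obtain s where s: "0 < s" "s < r" and ks: "?k r - ?k 0 = (r - 0) *
      (?gu (x + s *\<^sub>R u + r *\<^sub>R v) - ?gu (x + s *\<^sub>R u + 0 *\<^sub>R v))" by blast
  have "\<exists>t. 0 < t \<and> t < r \<and> ?gu (x + s *\<^sub>R u + r *\<^sub>R v) - ?gu (x + s *\<^sub>R u + 0 *\<^sub>R v)
      = (r - 0) * frechet_derivative ?gu (at (x + s *\<^sub>R u + t *\<^sub>R v)) v"
    using r s by (intro MVT2 lin2) auto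
  then obtain t where t: "0 < t" "t < r" "?gu (x + s *\<^sub>R u + r *\<^sub>R v) - ?gu (x + s *\<^sub>R u + 0 *\<^sub>R v)
      = (r - 0) * frechet_derivative ?gu (at (x + s *\<^sub>R u + t *\<^sub>R v)) v" by blast
  show ?thesis
    using ks unfolding t(3) by (intro that[OF s t(1,2)]) (simp add: algebra_simps)
qed

lemma second_derivative_symmetric_real:
  fixes g :: "'a::real_normed_vector \<Rightarrow> real"
  assumes sm: "smooth_on S g" and x: "x \<in> S"
  shows "frechet_derivative (\<lambda>y. frechet_derivative g (at y) u) (at x) v
       = frechet_derivative (\<lambda>y. frechet_derivative g (at y) v) (at x) u"
proof -
  define P where "P = (\<lambda>y. frechet_derivative (\<lambda>y. frechet_derivative g (at y) u) (at y) v)"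
  define Q where "Q = (\<lambda>y. frechet_derivative (\<lambda>y. frechet_derivative g (at y) v) (at y) u)"
  have "smooth_on S P" "smooth_on S Q"
    unfolding P_def Q_def by (intro smooth_on_frechet_derivative sm)+
  then have cont: "isCont P x" "isCont Q x"
    using smooth_on_imp_continuous_on smooth_on_open[OF sm] x continuous_on_eq_continuous_at by blast+
  \<comment> \<open>The summand 1 keeps \<open>c\<close> positive when \<open>u\<close> and
    \<open>v\<close> both vanish; with \<open>r = d / c\<close> the whole parallelogram lies within
    distance \<open>d\<close> of \<open>x\<close>.\<close>
  define c where "c = norm u + norm v + 1"
  have c: "0 < c" unfolding c_def by (smt (verit) norm_ge_zero)
  have "dist (P x) (Q x) \<le> e" if e: "0 < e" for e :: real
  proof -
    obtain d1 where d1: "d1 > 0" "\<And>y. dist y x < d1 \<Longrightarrow> dist (P y) (P x) < e/2"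
      using cont(1) e unfolding continuous_at_eps_delta by (metis half_gt_zero)
    obtain d2 where d2: "d2 > 0" "\<And>y. dist y x < d2 \<Longrightarrow> dist (Q y) (Q x) < e/2"
      using cont(2) e unfolding continuous_at_eps_delta by (metis half_gt_zero)
    obtain d3 where d3: "d3 > 0" "\<And>y. dist y x < d3 \<Longrightarrow> y \<in> S"
      using smooth_on_open[OF sm] x unfolding open_dist by blast
    define d where "d = min d1 (min d2 d3)"
    have d: "0 < d" using d1 d2 d3 by (simp add: d_def)
    define r where "r = d / c"
    have r: "0 < r" "r * c = d" using d c by (auto simp: r_def)
    have near: "dist (x + s *\<^sub>R u' + t *\<^sub>R v') x < d"
      if "0 \<le> s" "s \<le> r" "0 \<le> t" "t \<le> r" "norm u' + norm v' = norm u + norm v" for s t u' v'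
    proof -
      have "dist (x + s *\<^sub>R u' + t *\<^sub>R v') x = norm (s *\<^sub>R u' + t *\<^sub>R v')"
        by (simp add: dist_norm add.assoc)
      also have "\<dots> \<le> s * norm u' + t * norm v'"
        using norm_triangle_ineq[of "s *\<^sub>R u'" "t *\<^sub>R v'"] that by simp
      also have "\<dots> \<le> r * norm u' + r * norm v'"
        using that by (intro add_mono mult_right_mono) auto
      also have "\<dots> < r * c"
        using r(1) that(5) by (simp add: c_def flip: distrib_left)
      finally show ?thesis using r(2) by simp
    qed
    obtain s t where st: "0 < s" "s < r" "0 < t" "t < r"
      "g (x + r *\<^sub>R u + r *\<^sub>R v) - g (x + r *\<^sub>R u) - g (x + r *\<^sub>R v) + g x
        = r * (r * P (x + s *\<^sub>R u + t *\<^sub>R v))"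
      unfolding P_def
      by (rule second_difference_mean_value[OF sm r(1), of x u v])
         (use near d3 in \<open>auto simp: d_def\<close>)
    obtain s' t' where st': "0 < s'" "s' < r" "0 < t'" "t' < r"
      "g (x + r *\<^sub>R v + r *\<^sub>R u) - g (x + r *\<^sub>R v) - g (x + r *\<^sub>R u) + g x
        = r * (r * Q (x + s' *\<^sub>R v + t' *\<^sub>R u))"
      unfolding Q_def
      by (rule second_difference_mean_value[OF sm r(1), of x v u])
         (use near[of _ _ v u] d3 in \<open>auto simp: d_def\<close>)
    \<comment> \<open>The second difference does not change when \<open>u\<close> and
      \<open>v\<close> are exchanged, so \<open>P\<close> at one nearby point equals
      \<open>Q\<close> at another.\<close>
    have "r * (r * P (x + s *\<^sub>R u + t *\<^sub>R v)) = r * (r * Q (x + s' *\<^sub>R v + t' *\<^sub>R u))"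
      using st(5) st'(5) by (simp add: algebra_simps)
    then have eq: "P (x + s *\<^sub>R u + t *\<^sub>R v) = Q (x + s' *\<^sub>R v + t' *\<^sub>R u)"
      using r(1) by simp
    have "dist (P (x + s *\<^sub>R u + t *\<^sub>R v)) (P x) < e/2"
      using near[of s t u v] st d1(2) by (simp add: d_def)
    moreover have "dist (Q (x + s' *\<^sub>R v + t' *\<^sub>R u)) (Q x) < e/2"
      using near[of s' t' v u] st' d2(2) by (simp add: d_def)
    ultimately show ?thesis
      using eq by (smt (verit) dist_commute dist_triangle_half_r)
  qed
  then have "P x = Q x" by (metis dense_le_bounded dist_le_zero_iff field_le_epsilon add_0)
  then show ?thesis by (simp add: P_def Q_def)
qed

lemma frechet_derivative_inner_const:
  assumes "g differentiable (at x)"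
  shows "frechet_derivative (\<lambda>y. g y \<bullet> c) (at x) v = frechet_derivative g (at x) v \<bullet> c"
  using frechet_derivative_eqI[OF has_derivative_inner_left[OF has_derivative_frechet[OF assms], of c]]
  by simp

lemma smooth_on_imp_differentiable: "smooth_on S g \<Longrightarrow> x \<in> S \<Longrightarrow> g differentiable (at x)"
  using smooth_on_has_derivative differentiableI by blast

text \<open>Reduces to the real case componentwise: the inner product with a basis vector commutes
  with both differentiations.\<close>

lemma second_derivative_symmetric:
  fixes g :: "'a::real_normed_vector \<Rightarrow> 'b::euclidean_space"
  assumes sm: "smooth_on S g" and x: "x \<in> S"
  shows "frechet_derivative (\<lambda>y. frechet_derivative g (at y) u) (at x) v
       = frechet_derivative (\<lambda>y. frechet_derivative g (at y) v) (at x) u"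
proof (rule euclidean_eqI)
  fix i :: 'b assume "i \<in> Basis"
  have 1: "frechet_derivative (\<lambda>y. frechet_derivative (\<lambda>y. g y \<bullet> i) (at y) u) (at x) v
    = frechet_derivative (\<lambda>y. frechet_derivative g (at y) u) (at x) v \<bullet> i" for u v
  proof -
    have "frechet_derivative (\<lambda>y. frechet_derivative (\<lambda>y. g y \<bullet> i) (at y) u) (at x)
      = frechet_derivative (\<lambda>y. frechet_derivative g (at y) u \<bullet> i) (at x)"
      by (intro frechet_derivative_cong_open[OF smooth_on_open[OF sm] x]
          frechet_derivative_inner_const smooth_on_imp_differentiable[OF sm])
    then show ?thesis
      by (simp add: frechet_derivative_inner_const
          smooth_on_imp_differentiable[OF smooth_on_frechet_derivative[OF sm] x])
  qed
  have "smooth_on S (\<lambda>y. g y \<bullet> i)"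
    by (intro smooth_on_inner sm smooth_on_const smooth_on_open[OF sm])
  from second_derivative_symmetric_real[OF this x] show
    "frechet_derivative (\<lambda>y. frechet_derivative g (at y) u) (at x) v \<bullet> i
       = frechet_derivative (\<lambda>y. frechet_derivative g (at y) v) (at x) u \<bullet> i"
    by (simp add: 1)
qed

section \<open>Product rules and the derivative of a unit vector field\<close>

abbreviation fderiv :: "('a::real_normed_vector \<Rightarrow> 'b::real_normed_vector) \<Rightarrow> 'a \<Rightarrow> 'a \<Rightarrow> 'b" ("\<D>")
  where "\<D> g x \<equiv> frechet_derivative g (at x)"

lemma frechet_derivative_inner:
  assumes "g differentiable (at x)" "h differentiable (at x)"
  shows "\<D> (\<lambda>y. g y \<bullet> h y) x v = g x \<bullet> \<D> h x v + \<D> g x v \<bullet> h x"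
  using assms by (subst frechet_derivative_eqI[OF has_derivative_inner]) (auto intro: has_derivative_frechet)

lemma frechet_derivative_scaleR:
  assumes "g differentiable (at x)" "h differentiable (at x)"
  shows "\<D> (\<lambda>y. g y *\<^sub>R h y) x v = g x *\<^sub>R \<D> h x v + \<D> g x v *\<^sub>R h x"
  using assms by (subst frechet_derivative_eqI[OF has_derivative_scaleR]) (auto intro: has_derivative_frechet)

text \<open>Differentiate the constant \<open>N \<bullet> N = 1\<close>.\<close>

lemma frechet_derivative_unit_orthogonal:
  fixes N :: "'a::real_normed_vector \<Rightarrow> 'b::euclidean_space"
  assumes "smooth_on W N" "\<And>x. x \<in> W \<Longrightarrow> norm (N x) = 1" "x \<in> W"
  shows "\<D> N x v \<bullet> N x = 0"
proof -
  have "\<D> (\<lambda>y. N y \<bullet> N y) x = \<D> (\<lambda>y. 1) x"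
    using assms by (intro frechet_derivative_cong_open[OF smooth_on_open[OF assms(1)]])
      (auto simp: norm_eq_1)
  moreover have "N differentiable (at x)" using assms smooth_on_imp_differentiable by blast
  ultimately show ?thesis
    using frechet_derivative_inner[of N x N v] by (simp add: inner_commute)
qed

subsection \<open>Functions constant on the leaves of a foliation\<close>

text \<open>The condition is infinitesimal: \<open>dG\<close> kills the tangent spaces of the level
  sets of \<open>g\<close>. It leaves open whether \<open>G\<close> agrees on different components
  of one level set.\<close>

definition leafwise_constant ::
  "'a::real_normed_vector set \<Rightarrow> ('a \<Rightarrow> real) \<Rightarrow> ('a \<Rightarrow> 'b::real_normed_vector) \<Rightarrow> bool" where
  "leafwise_constant W g G \<longleftrightarrow> smooth_on W G \<and> (\<forall>x\<in>W. \<forall>v. \<D> g x v = 0 \<longrightarrow> \<D> G x v = 0)"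

text \<open>This is the coefficient \<open>B\<close> in \<open>dG = B dg\<close>, read off in a
  direction \<open>w\<close> transversal to the leaves.\<close>

definition leaf_deriv ::
  "('a::real_normed_vector \<Rightarrow> real) \<Rightarrow> 'a \<Rightarrow> ('a \<Rightarrow> 'b::real_normed_vector) \<Rightarrow> 'a \<Rightarrow> 'b" where
  "leaf_deriv g w G = (\<lambda>x. inverse (\<D> g x w) *\<^sub>R \<D> G x w)"

text \<open>Split \<open>u\<close> into a multiple of \<open>w\<close> and a vector in the kernel of
  \<open>dg\<close>, which \<open>dG\<close> kills as well.\<close>

lemma leafwise_constant_frechet_derivative:
  assumes "smooth_on W g" "\<And>x. x \<in> W \<Longrightarrow> \<D> g x w \<noteq> 0" "leafwise_constant W g G" "x \<in> W"
  shows "\<D> G x u = \<D> g x u *\<^sub>R leaf_deriv g w G x"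
proof -
  have lin: "linear (\<D> g x)" "linear (\<D> G x)"
    using assms smooth_on_linear unfolding leafwise_constant_def by blast+
  define t where "t = \<D> g x u / \<D> g x w"
  have "\<D> g x (u - t *\<^sub>R w) = 0"
    using assms(2,4) by (simp add: linear_diff[OF lin(1)] linear_cmul[OF lin(1)] t_def)
  then have "\<D> G x (u - t *\<^sub>R w) = 0"
    using assms(3,4) unfolding leafwise_constant_def by blast
  then show ?thesis
    by (simp add: linear_diff[OF lin(2)] linear_cmul[OF lin(2)] t_def leaf_deriv_def divide_inverse)
qed

text \<open>With \<open>B = leaf_deriv g w G\<close>, taking the exterior derivative of \<open>dG = B dg\<close> gives
  \<open>dB \<and> dg = 0\<close>.\<close>

lemma leafwise_constant_leaf_deriv:
  fixes G :: "'a::real_normed_vector \<Rightarrow> 'b::euclidean_space"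
  assumes g: "smooth_on W g" and gw: "\<And>x. x \<in> W \<Longrightarrow> \<D> g x w \<noteq> 0" and G: "leafwise_constant W g G"
  shows "leafwise_constant W g (leaf_deriv g w G)"
proof -
  let ?B = "leaf_deriv g w G"
  have smG: "smooth_on W G" using G by (simp add: leafwise_constant_def)
  have smB: "smooth_on W ?B"
    unfolding leaf_deriv_def
    by (intro smooth_on_scaleR smooth_on_inverse smooth_on_frechet_derivative g smG gw)
  have "\<D> ?B x v = 0" if x: "x \<in> W" and v: "\<D> g x v = 0" for x v
  proof -
    have second: "\<D> (\<lambda>y. \<D> G y u) x u' = \<D> g x u *\<^sub>R \<D> ?B x u' + \<D> (\<lambda>y. \<D> g y u) x u' *\<^sub>R ?B x" for u u'
    proof -
      have "\<D> (\<lambda>y. \<D> G y u) x = \<D> (\<lambda>y. \<D> g y u *\<^sub>R ?B y) x"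
        using leafwise_constant_frechet_derivative[OF g gw G]
        by (intro frechet_derivative_cong_open[OF smooth_on_open[OF g] x]) auto
      then show ?thesis
        by (simp add: frechet_derivative_scaleR smooth_on_imp_differentiable[OF _ x]
            smooth_on_frechet_derivative[OF g] smB)
    qed
    \<comment> \<open>Exchanging \<open>v\<close> and \<open>w\<close> leaves the second derivatives
      of \<open>G\<close> and \<open>g\<close> unchanged, hence
      \<open>dg(w) dB(v) = dg(v) dB(w)\<close>, and the right side is 0.\<close>
    have "\<D> g x w *\<^sub>R \<D> ?B x v = 0"
      using second[of w v] second[of v w] v
      by (simp add: second_derivative_symmetric[OF smG x, of v w]
          second_derivative_symmetric[OF g x, of v w])
    then show ?thesis using gw[OF x] by simp
  qed
  then show ?thesis using smB by (simp add: leafwise_constant_def)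
qed

lemma smooth_on_has_vector_derivative_compose:
  assumes h: "smooth_on W h" and c: "(c has_vector_derivative c') (at s)" and W: "c s \<in> W"
  shows "((\<lambda>s. h (c s)) has_vector_derivative \<D> h (c s) c') (at s)"
proof -
  have "((\<lambda>s. h (c s)) has_derivative (\<lambda>t. \<D> h (c s) (t *\<^sub>R c'))) (at s)"
    by (rule has_derivative_compose[OF c[unfolded has_vector_derivative_def]
          smooth_on_has_derivative[OF h W]])
  then show ?thesis
    unfolding has_vector_derivative_def by (simp add: linear_cmul[OF smooth_on_linear[OF h W]])
qed

text \<open>The velocity of a curve inside a level set of \<open>g\<close> lies in the kernel of
  \<open>dg\<close>, so the derivative of \<open>G\<close> along the curve vanishes on the whole
  interval.\<close>

lemma leafwise_constant_along_curve:
  fixes c :: "real \<Rightarrow> 'a::real_normed_vector" and G :: "'a \<Rightarrow> 'b::real_normed_vector"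
    and g :: "'a \<Rightarrow> real"
  assumes G: "leafwise_constant W g G" and g: "smooth_on W g"
    and c: "\<And>s. \<bar>s\<bar> < r \<Longrightarrow> (c has_vector_derivative c' s) (at s)"
    and cW: "\<And>s. \<bar>s\<bar> < r \<Longrightarrow> c s \<in> W"
    and gc: "\<And>s. \<bar>s\<bar> < r \<Longrightarrow> g (c s) = g (c 0)"
    and s: "\<bar>s\<bar> < r"
  shows "\<D> g (c s) (c' s) = 0" "G (c s) = G (c 0)"
proof -
  let ?I = "{-r<..<r}"
  have dg: "\<D> g (c s) (c' s) = 0" if "\<bar>s\<bar> < r" for s
  proof -
    have "((\<lambda>s. g (c s)) has_vector_derivative 0) (at s)"
      by (rule has_vector_derivative_transform_within_open[of "\<lambda>s. g (c 0)" _ _ ?I])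
         (use that in \<open>auto intro!: gc[symmetric]\<close>)
    moreover have "((\<lambda>s. g (c s)) has_vector_derivative \<D> g (c s) (c' s)) (at s)"
      using smooth_on_has_vector_derivative_compose[OF g c[OF that] cW[OF that]] .
    ultimately show ?thesis using vector_derivative_unique_at by blast
  qed
  show "\<D> g (c s) (c' s) = 0" by (rule dg[OF s])
  have smG: "smooth_on W G" using G by (simp add: leafwise_constant_def)
  obtain k where "\<And>s. s \<in> ?I \<Longrightarrow> G (c s) = k"
  proof (rule has_vector_derivative_zero_constant[of ?I "\<lambda>s. G (c s)"])
    fix s assume "s \<in> ?I"
    then have "\<bar>s\<bar> < r" by auto
    then have "((\<lambda>s. G (c s)) has_vector_derivative \<D> G (c s) (c' s)) (at s)"
      and "\<D> G (c s) (c' s) = 0"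
      using smooth_on_has_vector_derivative_compose[OF smG c cW] dg cW G
      unfolding leafwise_constant_def by blast+
    then show "((\<lambda>s. G (c s)) has_vector_derivative 0) (at s within ?I)"
      using has_vector_derivative_at_within by fastforce
  qed auto
  then have "G (c t) = k" if "\<bar>t\<bar> < r" for t using that by (auto simp: abs_less_iff)
  then show "G (c s) = G (c 0)" using s by simp
qed

text \<open>The map \<open>K \<circ> F + (g / \<D> g x0 w) w\<close> has derivative \<open>id\<close> at \<open>x0\<close>;
  its local inverse carries a straight line to a curve inside the leaf through \<open>x0\<close>.\<close>

lemma exists_leaf_curve:
  fixes F :: "'a::euclidean_space \<Rightarrow> 'b::euclidean_space" and g :: "'a \<Rightarrow> real"
  assumes F: "smooth_on W F" and g: "smooth_on W g" and x0: "x0 \<in> W"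
    and w: "\<D> g x0 w \<noteq> 0" "\<D> F x0 w = 0"
    and inj: "\<And>u. \<D> g x0 u = 0 \<Longrightarrow> \<D> F x0 u = 0 \<Longrightarrow> u = 0"
    and u0: "\<D> g x0 u0 = 0"
  obtains c c' r K where "0 < r" "c 0 = x0" "linear K" "\<And>u. \<D> g x0 u = 0 \<Longrightarrow> K (\<D> F x0 u) = u"
    "\<And>s. \<bar>s\<bar> < r \<Longrightarrow> (c has_vector_derivative c' s) (at s)"
    "\<And>s. \<bar>s\<bar> < r \<Longrightarrow> c s \<in> W" "\<And>s. \<bar>s\<bar> < r \<Longrightarrow> g (c s) = g (c 0)"
    "\<And>s. \<bar>s\<bar> < r \<Longrightarrow> K (F (c s)) = K (F x0) + s *\<^sub>R u0"
proof -
  have lg: "linear (\<D> g x0)" and lF: "linear (\<D> F x0)"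
    using smooth_on_linear g F x0 by blast+
  let ?V = "{u. \<D> g x0 u = 0}"
  have V: "subspace ?V" using lg by (rule linear_subspace_kernel)
  have "inj_on (\<D> F x0) ?V"
  proof (rule inj_onI)
    fix u v assume "u \<in> ?V" "v \<in> ?V" "\<D> F x0 u = \<D> F x0 v"
    then have "u - v = 0" by (intro inj) (simp_all add: linear_diff[OF lg] linear_diff[OF lF])
    then show "u = v" by simp
  qed
  \<comment> \<open>\<open>K\<close> inverts \<open>dF\<close> on the tangent space of the leaf at
    \<open>x0\<close> and takes all its values in that space.\<close>
  then obtain K where KV: "range K \<subseteq> ?V" and lK: "linear K" and K: "\<And>v. v \<in> ?V \<Longrightarrow> K (\<D> F x0 v) = v"
    using linear_exists_left_inverse_on[OF lF V] by blast
  have bK: "bounded_linear K" using lK linear_conv_bounded_linear by blast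
  define \<alpha> where "\<alpha> = \<D> g x0 w"
  define \<Phi> where "\<Phi> = (\<lambda>x. K (F x) + (g x / \<alpha>) *\<^sub>R w)"
  define \<Phi>' where "\<Phi>' = (\<lambda>x. Blinfun (\<lambda>u. K (\<D> F x u) + (\<D> g x u / \<alpha>) *\<^sub>R w))"
  have der: "(\<Phi> has_derivative (\<lambda>u. K (\<D> F x u) + (\<D> g x u / \<alpha>) *\<^sub>R w)) (at x)" if "x \<in> W" for x
    unfolding \<Phi>_def divide_inverse
    by (intro has_derivative_add bounded_linear.has_derivative[OF bK]
        has_derivative_scaleR_left has_derivative_mult_left smooth_on_has_derivative[OF F that]
        smooth_on_has_derivative[OF g that])
  have app: "blinfun_apply (\<Phi>' x) = (\<lambda>u. K (\<D> F x u) + (\<D> g x u / \<alpha>) *\<^sub>R w)" if "x \<in> W" for x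
    unfolding \<Phi>'_def using has_derivative_bounded_linear[OF der[OF that]]
    by (rule bounded_linear_Blinfun_apply)
  have der': "(\<Phi> has_derivative blinfun_apply (\<Phi>' x)) (at x)" if "x \<in> W" for x
    using der[OF that] by (simp add: app[OF that])
  have cont: "continuous_on W \<Phi>'"
  proof (rule continuous_on_blinfun_componentwise)
    fix i :: 'a
    have "continuous_on W (\<lambda>x. K (\<D> F x i) + (\<D> g x i / \<alpha>) *\<^sub>R w)"
      unfolding divide_inverse
      by (intro continuous_intros bounded_linear.continuous_on[OF bK]
          smooth_on_imp_continuous_on smooth_on_frechet_derivative F g)
    then show "continuous_on W (\<lambda>x. \<Phi>' x i)" by (simp add: app cong: continuous_on_cong)
  qed
  \<comment> \<open>On the kernel of \<open>dg\<close> the map \<open>K\<close> undoes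
    \<open>dF\<close>, and \<open>w\<close> is sent to itself because \<open>dF\<close> kills it;
    these two pieces span the space.\<close>
  have id: "id_blinfun o\<^sub>L \<Phi>' x0 = id_blinfun"
  proof (rule blinfun_eqI)
    fix u
    let ?t = "\<D> g x0 u / \<alpha>"
    have "u - ?t *\<^sub>R w \<in> ?V"
      using w(1) by (simp add: linear_diff[OF lg] linear_cmul[OF lg] \<alpha>_def)
    then have "K (\<D> F x0 (u - ?t *\<^sub>R w)) = u - ?t *\<^sub>R w" by (rule K)
    then have "K (\<D> F x0 u) = u - ?t *\<^sub>R w"
      by (simp add: linear_diff[OF lF] linear_cmul[OF lF] w(2))
    then show "blinfun_apply (id_blinfun o\<^sub>L \<Phi>' x0) u = blinfun_apply id_blinfun u"
      by (simp add: app[OF x0])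
  qed
  obtain U V \<psi> \<psi>' where "open U" and U: "U \<subseteq> W" "x0 \<in> U" and "open V" and V: "\<Phi> x0 \<in> V"
    and hom: "homeomorphism U V \<Phi> \<psi>"
    and der\<psi>: "\<And>y. y \<in> V \<Longrightarrow> (\<psi> has_derivative (\<psi>' y)) (at y)"
    by (rule inverse_function_theorem[OF smooth_on_open[OF F] der' cont x0 id]) blast+
  define l where "l = (\<lambda>s::real. \<Phi> x0 + s *\<^sub>R u0)"
  have "continuous_on UNIV l" unfolding l_def by (intro continuous_intros)
  then have "open (l -` V)" using \<open>open V\<close> by (simp add: open_vimage)
  moreover have "0 \<in> l -` V" using V by (simp add: l_def)
  ultimately obtain r where r0: "0 < r" "\<forall>s. dist s 0 < r \<longrightarrow> s \<in> l -` V"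
    unfolding open_dist by blast
  then have r: "0 < r" "\<And>s. \<bar>s\<bar> < r \<Longrightarrow> l s \<in> V" by auto
  define c where "c = (\<lambda>s. \<psi> (l s))"
  have cU: "c s \<in> U" and \<Phi>c: "\<Phi> (c s) = l s" if "\<bar>s\<bar> < r" for s
    using r(2)[OF that] hom unfolding homeomorphism_def c_def by auto
  have dgK: "\<D> g x0 (K y) = 0" for y using KV by auto
  \<comment> \<open>The form \<open>dg\<close> at \<open>x0\<close> kills the range of
    \<open>K\<close>, so it recovers \<open>g\<close> from \<open>\<Phi>\<close>. Hence the preimage
    of a line with direction \<open>u0\<close> in its kernel stays in one level set of
    \<open>g\<close>.\<close>
  have d\<Phi>: "\<D> g x0 (\<Phi> x) = g x" for x
    using w(1) by (simp add: \<Phi>_def linear_add[OF lg] linear_cmul[OF lg] dgK \<alpha>_def)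
  have gc: "g (c s) = g x0" if "\<bar>s\<bar> < r" for s
    using d\<Phi>[of "c s"] d\<Phi>[of x0] \<Phi>c[OF that] u0
    by (simp add: l_def linear_add[OF lg] linear_cmul[OF lg])
  have c0: "c 0 = x0" using hom U(2) unfolding c_def l_def homeomorphism_def by auto
  show ?thesis
  proof (rule that[of r c K "\<lambda>s. \<psi>' (l s) u0"])
    show "(c has_vector_derivative \<psi>' (l s) u0) (at s)" if "\<bar>s\<bar> < r" for s
    proof -
      have "(l has_derivative (\<lambda>t. t *\<^sub>R u0)) (at s)"
        unfolding l_def by (auto intro!: derivative_eq_intros)
      from has_derivative_compose[OF this der\<psi>[OF r(2)[OF that]]] show ?thesis
        unfolding has_vector_derivative_def c_def
        by (simp add: linear_cmul[OF has_derivative_linear[OF der\<psi>[OF r(2)[OF that]]]])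
    qed
    show "K (F (c s)) = K (F x0) + s *\<^sub>R u0" if "\<bar>s\<bar> < r" for s
      using \<Phi>c[OF that] gc[OF that] by (simp add: \<Phi>_def l_def)
  qed (use r lK K cU U gc c0 in auto)
qed

text \<open>The image lies in the hyperplane and has the same dimension.\<close>

lemma range_linear_inj_hyperplane:
  fixes L :: "'a::euclidean_space \<Rightarrow> 'b::euclidean_space"
  assumes "linear L" "inj L" "DIM('b) = DIM('a) + 1" "N \<noteq> 0" "\<And>u. L u \<bullet> N = 0"
  shows "range L = {y. N \<bullet> y = 0}"
proof (rule subspace_dim_equal)
  show "subspace (range L)" using assms(1) by (simp add: linear_subspace_image)
  show "subspace {y. N \<bullet> y = 0}" by (rule subspace_hyperplane)
  show "range L \<subseteq> {y. N \<bullet> y = 0}" using assms(5) by (auto simp: inner_commute)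
  have "dim (range L) = DIM('a)" using assms(1,2) dim_image_eq[of L UNIV] by simp
  then show "dim {y. N \<bullet> y = 0} \<le> dim (range L)"
    using assms(3,4) by (simp add: dim_hyperplane)
qed

subsection \<open>Flatness\<close>

text \<open>With \<open>z\<close> arbitrary, the conclusion expresses that the rank of
  \<open>dN\<close> is at most one. It is the curvature of \<open>D\<close> on constant vector
  fields, applied to the tangential projection of the constant vector \<open>z\<close>.\<close>

lemma flat_imp_rank_normal_le_one:
  fixes N :: "real^'n \<Rightarrow> 'b::euclidean_space"
  assumes N: "smooth_on W N" and unit: "\<And>x. x \<in> W \<Longrightarrow> norm (N x) = 1"
    and flat: "\<And>\<xi> X Y x. \<lbrakk>smooth_on W \<xi>; smooth_on W X; smooth_on W Y;
        \<And>x. x \<in> W \<Longrightarrow> \<xi> x \<bullet> N x = 0; x \<in> W\<rbrakk> \<Longrightarrow> curvD N X Y \<xi> x = 0"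
    and x: "x \<in> W"
  shows "(z \<bullet> \<D> N x v) *\<^sub>R \<D> N x u = (z \<bullet> \<D> N x u) *\<^sub>R \<D> N x v"
proof -
  have W: "open W" using N by (rule smooth_on_open)
  have NN: "N y \<bullet> N y = 1" if "y \<in> W" for y using unit[OF that] by (simp add: norm_eq_1)
  have dN: "\<D> N y t \<bullet> N y = 0" if "y \<in> W" for y t
    using frechet_derivative_unit_orthogonal[OF N unit that] .
  have dif: "N differentiable (at y)" if "y \<in> W" for y
    using smooth_on_imp_differentiable[OF N that] .
  define \<xi> where "\<xi> = (\<lambda>y. z - (z \<bullet> N y) *\<^sub>R N y)"
  have sm\<xi>: "smooth_on W \<xi>"
    unfolding \<xi>_def by (intro smooth_on_diff smooth_on_const smooth_on_scaleR smooth_on_inner W N)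
  \<comment> \<open>The values of \<open>dN\<close> are tangential, so the projection only removes
    the multiple of \<open>N\<close>.\<close>
  have D1: "Dcov N (\<lambda>_. t) \<xi> y = - ((z \<bullet> N y) *\<^sub>R \<D> N y t)" if y: "y \<in> W" for y t
  proof -
    have "(\<xi> has_derivative (\<lambda>h. 0 - ((z \<bullet> N y) *\<^sub>R \<D> N y h + (z \<bullet> \<D> N y h) *\<^sub>R N y))) (at y)"
      unfolding \<xi>_def
      by (intro has_derivative_diff has_derivative_const has_derivative_scaleR
          has_derivative_inner_right has_derivative_frechet[OF dif[OF y]])
    then have "\<D> \<xi> y t = - ((z \<bullet> N y) *\<^sub>R \<D> N y t) - (z \<bullet> \<D> N y t) *\<^sub>R N y"
      using frechet_derivative_eqI by fastforce
    then show ?thesis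
      using dN[OF y] NN[OF y] by (simp add: Dcov_def inner_diff_left)
  qed
  \<comment> \<open>Only the first term changes when \<open>s\<close> and \<open>t\<close> are
    exchanged: the others contain \<open>dN\<close> differentiated twice, which is symmetric. The
    commutator thus leaves the claimed identity.\<close>
  have D2: "Dcov N (\<lambda>_. s) (Dcov N (\<lambda>_. t) \<xi>) x = - ((z \<bullet> \<D> N x s) *\<^sub>R \<D> N x t)
      - (z \<bullet> N x) *\<^sub>R \<D> (\<lambda>y. \<D> N y t) x s
      + ((z \<bullet> N x) * (\<D> (\<lambda>y. \<D> N y t) x s \<bullet> N x)) *\<^sub>R N x" for s t
  proof -
    have "\<D> (Dcov N (\<lambda>_. t) \<xi>) x = \<D> (\<lambda>y. - ((z \<bullet> N y) *\<^sub>R \<D> N y t)) x"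
      by (rule frechet_derivative_cong_open[OF W x D1])
    also have "\<dots> = (\<lambda>h. - ((z \<bullet> N x) *\<^sub>R \<D> (\<lambda>y. \<D> N y t) x h + (z \<bullet> \<D> N x h) *\<^sub>R \<D> N x t))"
      by (intro frechet_derivative_eqI has_derivative_minus has_derivative_scaleR
          has_derivative_inner_right has_derivative_frechet dif x
          smooth_on_imp_differentiable[OF smooth_on_frechet_derivative[OF N]])
    finally show ?thesis
      unfolding Dcov_def[of N "\<lambda>_. s"]
      using dN[OF x] by (simp add: algebra_simps)
  qed
  have bracket: "vf_bracket (\<lambda>_. u) (\<lambda>_. v) = (\<lambda>_. 0)"
    by (simp add: vf_bracket_def)
  have "curvD N (\<lambda>_. u) (\<lambda>_. v) \<xi> x = 0"
  proof (rule flat[OF sm\<xi>])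
    show "\<xi> y \<bullet> N y = 0" if "y \<in> W" for y
      using NN[OF that] by (simp add: \<xi>_def inner_diff_left)
  qed (intro smooth_on_const W x)+
  moreover have "Dcov N (\<lambda>_. 0) \<xi> x = 0"
    by (simp add: Dcov_def linear_0[OF smooth_on_linear[OF sm\<xi> x]])
  ultimately have "Dcov N (\<lambda>_. u) (Dcov N (\<lambda>_. v) \<xi>) x = Dcov N (\<lambda>_. v) (Dcov N (\<lambda>_. u) \<xi>) x"
    by (simp add: curvD_def bracket)
  then show ?thesis
    unfolding D2 by (simp add: second_derivative_symmetric[OF N x, of v u])
qed

subsection \<open>Singular points of a flat front lie on straight segments of singular points\<close>

text \<open>The local statement in one chart: \<open>imm\<close> is the front condition and
  \<open>rank\<close> is flatness. The segment is the image of a curve inside the leaf through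
  \<open>x0\<close>, started in a direction in which the affine function cutting out the singular
  points does not change.\<close>

lemma exists_singular_segment:
  fixes F N :: "'a::euclidean_space \<Rightarrow> 'b::euclidean_space"
  assumes dim: "DIM('a) \<ge> 3" "DIM('b) = DIM('a) + 1"
    and F: "smooth_on W F" and N: "smooth_on W N"
    and unit: "\<And>x. x \<in> W \<Longrightarrow> norm (N x) = 1"
    and orth: "\<And>x v. x \<in> W \<Longrightarrow> \<D> F x v \<bullet> N x = 0"
    and imm: "\<And>x u. \<lbrakk>x \<in> W; \<D> F x u = 0; \<D> N x u = 0\<rbrakk> \<Longrightarrow> u = 0"
    and rank: "\<And>x u v z. x \<in> W \<Longrightarrow> (z \<bullet> \<D> N x v) *\<^sub>R \<D> N x u = (z \<bullet> \<D> N x u) *\<^sub>R \<D> N x v"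
    and x0: "x0 \<in> W" and w: "w \<noteq> 0" "\<D> F x0 w = 0"
  obtains x1 x2 v where "x1 \<in> W" "x2 \<in> W" "v \<noteq> 0" "F x1 = F x0 + v" "F x2 = F x0 - v"
    "\<not> inj (\<D> F x1)" "\<not> inj (\<D> F x2)"
proof -
  \<comment> \<open>The front condition makes \<open>e0\<close> nonzero, since \<open>w\<close> is
    in the kernel of \<open>dF\<close>. With \<open>g\<close> the height of \<open>N\<close> in this
    direction, \<open>dg(w)\<close> at \<open>x0\<close> is the square of the norm of
    \<open>e0\<close>.\<close>
  define e0 where "e0 = \<D> N x0 w"
  have e0: "e0 \<noteq> 0" using imm[OF x0] w by (auto simp: e0_def)
  define g where "g = (\<lambda>x. N x \<bullet> e0)"
  have dg: "\<D> g x u = \<D> N x u \<bullet> e0" if "x \<in> W" for x u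
    unfolding g_def by (rule frechet_derivative_inner_const[OF smooth_on_imp_differentiable[OF N that]])
  \<comment> \<open>On \<open>W'\<close> the fixed vector \<open>w\<close> stays transversal to the
    leaves, as division by \<open>dg(w)\<close> in \<open>leaf_deriv\<close> requires.\<close>
  define W' where "W' = {x \<in> W. \<D> N x w \<bullet> e0 \<noteq> 0}"
  have W'W: "W' \<subseteq> W" by (auto simp: W'_def)
  have "open W'"
  proof -
    have "continuous_on W (\<lambda>x. \<D> N x w \<bullet> e0)"
      by (intro continuous_intros smooth_on_imp_continuous_on smooth_on_frechet_derivative N)
    then have "open ((\<lambda>x. \<D> N x w \<bullet> e0) -` (- {0}) \<inter> W)"
      using continuous_on_open_vimage[OF smooth_on_open[OF N]] by blast
    moreover have "W' = (\<lambda>x. \<D> N x w \<bullet> e0) -` (- {0}) \<inter> W" by (auto simp: W'_def)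
    ultimately show ?thesis by simp
  qed
  have F': "smooth_on W' F" and N': "smooth_on W' N"
    using smooth_on_subset[OF _ \<open>open W'\<close> W'W] F N by blast+
  have g: "smooth_on W' g"
    unfolding g_def by (intro smooth_on_inner smooth_on_const N' \<open>open W'\<close>)
  have gw: "\<D> g x w \<noteq> 0" if "x \<in> W'" for x using that by (simp add: dg W'_def)
  have x0': "x0 \<in> W'" using x0 e0 by (simp add: W'_def e0_def)

  \<comment> \<open>The rank identity with \<open>z = e0\<close> makes \<open>dN(v)\<close> a
    multiple of \<open>dN(w)\<close> with coefficient proportional to \<open>dg(v)\<close>.\<close>
  have lcN: "leafwise_constant W' g N"
    unfolding leafwise_constant_def
  proof (intro conjI ballI allI impI N')
    fix x v assume "x \<in> W'" "\<D> g x v = 0"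
    then have "x \<in> W" "e0 \<bullet> \<D> N x v = 0" "e0 \<bullet> \<D> N x w \<noteq> 0"
      using W'W dg[of x] gw[of x] by (auto simp: inner_commute)
    then show "\<D> N x v = 0" using rank[of x e0 v w] by simp
  qed
  \<comment> \<open>The support function. As \<open>dF\<close> is orthogonal to \<open>N\<close>,
    its differential is \<open>F \<bullet> dN\<close>, which vanishes along leaves; this is how
    \<open>F \<bullet> a\<close> is seen to be leafwise constant.\<close>
  define h where "h = (\<lambda>x. F x \<bullet> N x)"
  have dh: "\<D> h x v = F x \<bullet> \<D> N x v" if "x \<in> W'" for x v
    unfolding h_def using W'W that
    by (subst frechet_derivative_inner)
       (auto intro: smooth_on_imp_differentiable[OF F'] smooth_on_imp_differentiable[OF N'] orth)
  have lch: "leafwise_constant W' g h"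
    unfolding leafwise_constant_def
  proof (intro conjI ballI allI impI)
    show "smooth_on W' h" unfolding h_def by (intro smooth_on_inner F' N')
    show "\<D> h x v = 0" if "x \<in> W'" "\<D> g x v = 0" for x v
      using lcN that by (simp add: dh leafwise_constant_def)
  qed
  \<comment> \<open>In differentials: \<open>dN = a dg\<close>, \<open>da = b dg\<close>,
    \<open>dh = p dg\<close>, \<open>dp = k dg\<close>.\<close>
  define a where "a = leaf_deriv g w N"
  define b where "b = leaf_deriv g w a"
  define p where "p = leaf_deriv g w h"
  define k where "k = leaf_deriv g w p"
  have lca: "leafwise_constant W' g a"
    unfolding a_def by (rule leafwise_constant_leaf_deriv[OF g gw lcN])
  have lcb: "leafwise_constant W' g b"
    unfolding b_def by (rule leafwise_constant_leaf_deriv[OF g gw lca])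
  have lcp: "leafwise_constant W' g p"
    unfolding p_def by (rule leafwise_constant_leaf_deriv[OF g gw lch])
  have lck: "leafwise_constant W' g k"
    unfolding k_def by (rule leafwise_constant_leaf_deriv[OF g gw lcp])
  have dN: "\<D> N x u = \<D> g x u *\<^sub>R a x" if "x \<in> W'" for x u
    unfolding a_def by (rule leafwise_constant_frechet_derivative[OF g gw lcN that])
  have da: "\<D> a x u = \<D> g x u *\<^sub>R b x" if "x \<in> W'" for x u
    unfolding b_def by (rule leafwise_constant_frechet_derivative[OF g gw lca that])
  have dp: "\<D> p x u = \<D> g x u *\<^sub>R k x" if "x \<in> W'" for x u
    unfolding k_def by (rule leafwise_constant_frechet_derivative[OF g gw lcp that])
  have p_eq: "p x = F x \<bullet> a x" if "x \<in> W'" for x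
    using that by (simp add: p_def a_def leaf_deriv_def dh)
  have sma: "smooth_on W' a" using lca by (simp add: leafwise_constant_def)
  \<comment> \<open>Two expressions for the differential of \<open>p = F \<bullet> a\<close> are
    compared: \<open>k dg\<close> and \<open>F \<bullet> b dg + dF \<bullet> a\<close>.\<close>
  have key: "\<D> F x u \<bullet> a x = \<D> g x u * (k x - F x \<bullet> b x)" if x: "x \<in> W'" for x u
  proof -
    have "\<D> p x u = \<D> (\<lambda>y. F y \<bullet> a y) x u"
      by (rule fun_cong[OF frechet_derivative_cong_open[OF \<open>open W'\<close> x p_eq]])
    also have "\<dots> = F x \<bullet> \<D> a x u + \<D> F x u \<bullet> a x"
      by (intro frechet_derivative_inner smooth_on_imp_differentiable[OF _ x] F' sma)
    finally show ?thesis using dp[OF x, of u] by (simp add: da[OF x] algebra_simps)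
  qed
  \<comment> \<open>As \<open>dF(w) = 0\<close> but \<open>dg(w)\<close> is nonzero,
    \<open>key\<close> forces \<open>k = F \<bullet> b\<close> at \<open>x0\<close>, and then
    \<open>dF \<bullet> a\<close> vanishes there in every direction.\<close>
  have Fa0: "\<D> F x0 u \<bullet> a x0 = 0" for u
    using key[OF x0', of w] key[OF x0', of u] gw[OF x0'] w(2) by simp
  have k0: "k x0 = F x0 \<bullet> b x0"
    using key[OF x0', of w] gw[OF x0'] w(2) by simp
  have a0: "a x0 \<noteq> 0" using dN[OF x0', of w] e0 by (auto simp: e0_def)
  have N0: "N x0 \<noteq> 0" using unit[OF x0] by auto
  have aN: "a x0 \<bullet> N x0 = 0"
    using frechet_derivative_unit_orthogonal[OF N unit x0, of w] dN[OF x0', of w] gw[OF x0'] by simp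
  have lF0: "linear (\<D> F x0)" and lg0: "linear (\<D> g x0)"
    using smooth_on_linear F' g x0' by blast+
  have inj0: "u = 0" if "\<D> g x0 u = 0" "\<D> F x0 u = 0" for u
    using that dN[OF x0', of u] imm[OF x0] by simp

  \<comment> \<open>Here dimension at least 3 enters: two linear equations have a nonzero common
    solution. The first makes \<open>u0\<close> tangent to the leaf, the second keeps
    \<open>F \<bullet> b\<close> fixed along the segment.\<close>
  obtain u0 where u0: "u0 \<noteq> 0" "\<D> g x0 u0 = 0" "\<D> F x0 u0 \<bullet> b x0 = 0"
  proof -
    let ?L = "\<lambda>u. (\<D> g x0 u, \<D> F x0 u \<bullet> b x0)"
    have lin: "linear ?L"
      by (rule linearI) (simp_all add: linear_add[OF lg0] linear_add[OF lF0] linear_cmul[OF lg0]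
          linear_cmul[OF lF0] inner_add_left)
    have "\<not> inj ?L"
    proof
      assume "inj ?L"
      then have "dim (range ?L) = DIM('a)" using lin dim_image_eq[of ?L UNIV] by simp
      moreover have "dim (range ?L) \<le> DIM(real \<times> real)" by (rule dim_subset_UNIV)
      ultimately show False using dim(1) by simp
    qed
    then obtain u where "u \<noteq> 0" "?L u = 0" using linear_injective_0[OF lin] by blast
    then show ?thesis using that by (simp add: zero_prod_def)
  qed

  \<comment> \<open>At \<open>x0\<close> the leaf directions map onto everything orthogonal to
    \<open>N\<close> and \<open>a\<close>. Adding \<open>dg a\<close> to \<open>dF\<close> repairs
    its kernel, giving an isomorphism onto the hyperplane orthogonal to \<open>N\<close>; the
    component along \<open>a\<close> then detects \<open>dg(u)\<close>.\<close>
  have tangent: "\<exists>u. \<D> g x0 u = 0 \<and> y = \<D> F x0 u" if y: "y \<bullet> N x0 = 0" "y \<bullet> a x0 = 0" for y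
  proof -
    let ?L = "\<lambda>u. \<D> F x0 u + \<D> g x0 u *\<^sub>R a x0"
    have lin: "linear ?L"
      by (rule linearI) (simp_all add: linear_add[OF lg0] linear_add[OF lF0] linear_cmul[OF lg0]
          linear_cmul[OF lF0] algebra_simps)
    have La: "?L u \<bullet> a x0 = \<D> g x0 u * (a x0 \<bullet> a x0)" for u
      by (simp add: inner_add_left Fa0)
    have "inj ?L"
      unfolding linear_injective_0[OF lin]
    proof (intro allI impI)
      fix u assume L0: "?L u = 0"
      then have "\<D> g x0 u = 0" using La[of u] a0 by simp
      then show "u = 0" using L0 inj0 by simp
    qed
    then have "range ?L = {y. N x0 \<bullet> y = 0}"
      using orth[OF x0] aN by (intro range_linear_inj_hyperplane lin dim N0) (simp_all add: inner_add_left)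
    then obtain u where u: "y = ?L u" using y(1) by (auto simp: inner_commute)
    then have "\<D> g x0 u = 0" using La[of u] y(2) a0 by simp
    then show ?thesis using u by auto
  qed

  obtain c c' r K where r: "0 < r" and c0: "c 0 = x0" and K: "linear K" "\<And>u. \<D> g x0 u = 0 \<Longrightarrow> K (\<D> F x0 u) = u"
    and c: "\<And>s. \<bar>s\<bar> < r \<Longrightarrow> (c has_vector_derivative c' s) (at s)"
    and cW: "\<And>s. \<bar>s\<bar> < r \<Longrightarrow> c s \<in> W'" and gc: "\<And>s. \<bar>s\<bar> < r \<Longrightarrow> g (c s) = g (c 0)"
    and KF: "\<And>s. \<bar>s\<bar> < r \<Longrightarrow> K (F (c s)) = K (F x0) + s *\<^sub>R u0"
    by (rule exists_leaf_curve[OF F' g x0' gw[OF x0'] w(2) inj0 u0(2)]) blast+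
  have along: "\<D> g (c s) (c' s) = 0" "N (c s) = N x0" "a (c s) = a x0" "b (c s) = b x0" "k (c s) = k x0"
    if "\<bar>s\<bar> < r" for s
    using leafwise_constant_along_curve[OF lcN g c cW gc that]
      leafwise_constant_along_curve(2)[OF lca g c cW gc that]
      leafwise_constant_along_curve(2)[OF lcb g c cW gc that]
      leafwise_constant_along_curve(2)[OF lck g c cW gc that] by (simp_all add: c0)
  define v where "v = \<D> F x0 u0"
  have v0: "v \<noteq> 0" using inj0 u0 by (auto simp: v_def)
  \<comment> \<open>The velocity of \<open>F\<close> along \<open>c\<close> is orthogonal to
    \<open>N x0\<close> and \<open>a x0\<close>, so it is the image of a leaf direction at
    \<open>x0\<close>. On such images \<open>K\<close> is injective, and \<open>K\<close> sends the
    velocity to \<open>u0\<close>; hence the velocity is constantly \<open>v\<close>.\<close>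
  have Fc: "F (c s) = F x0 + s *\<^sub>R v" if s: "\<bar>s\<bar> < r" for s
  proof -
    have dFc: "((\<lambda>s. F (c s)) has_vector_derivative v) (at s)" if s: "\<bar>s\<bar> < r" for s
    proof -
      have der: "((\<lambda>s. F (c s)) has_vector_derivative \<D> F (c s) (c' s)) (at s)"
        by (rule smooth_on_has_vector_derivative_compose[OF F' c[OF s] cW[OF s]])
      have "\<D> F (c s) (c' s) \<bullet> N x0 = 0"
        using orth[of "c s"] cW[OF s] W'W along(2)[OF s] by auto
      moreover have "\<D> F (c s) (c' s) \<bullet> a x0 = 0"
        using key[OF cW[OF s], of "c' s"] along(1)[OF s] along(3)[OF s] by simp
      ultimately obtain u where u: "\<D> g x0 u = 0" "\<D> F (c s) (c' s) = \<D> F x0 u"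
        using tangent by blast
      have "((\<lambda>s. K (F (c s))) has_vector_derivative K (\<D> F (c s) (c' s))) (at s)"
        using bounded_linear.has_vector_derivative[OF _ der] K(1) linear_conv_bounded_linear by blast
      moreover have "((\<lambda>s. K (F (c s))) has_vector_derivative u0) (at s)"
      proof (rule has_vector_derivative_transform_within_open[of "\<lambda>s. K (F x0) + s *\<^sub>R u0" _ _ "{-r<..<r}"])
        show "((\<lambda>s. K (F x0) + s *\<^sub>R u0) has_vector_derivative u0) (at s)"
          by (auto intro!: derivative_eq_intros)
      qed (use s KF in auto)
      ultimately have "K (\<D> F (c s) (c' s)) = u0" by (rule vector_derivative_unique_at)
      then have "u = u0" using u K(2) by simp
      then show ?thesis using der u(2) by (simp add: v_def)
    qed
    obtain q where q: "\<And>s. s \<in> {-r<..<r} \<Longrightarrow> F (c s) - s *\<^sub>R v = q"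
    proof (rule has_vector_derivative_zero_constant[of "{-r<..<r}" "\<lambda>s. F (c s) - s *\<^sub>R v"])
      fix s assume "s \<in> {-r<..<r}"
      then have "((\<lambda>s. F (c s) - s *\<^sub>R v) has_vector_derivative v - v) (at s)"
        by (intro has_vector_derivative_diff dFc) (auto intro!: derivative_eq_intros)
      then show "((\<lambda>s. F (c s) - s *\<^sub>R v) has_vector_derivative 0) (at s within {-r<..<r})"
        using has_vector_derivative_at_within by fastforce
    qed auto
    from q[of 0] q[of s] r s c0 show ?thesis by (auto simp: abs_less_iff algebra_simps)
  qed
  \<comment> \<open>If \<open>dF\<close> were injective, its range would be the hyperplane
    orthogonal to \<open>N\<close> and would contain \<open>a\<close>. But
    \<open>k = F \<bullet> b\<close> persists along the segment, so \<open>dF\<close> is orthogonal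
    to \<open>a\<close>.\<close>
  have sing: "\<not> inj (\<D> F (c s))" if s: "\<bar>s\<bar> < r" for s
  proof
    assume "inj (\<D> F (c s))"
    moreover have "\<D> F (c s) u \<bullet> N x0 = 0" for u
      using orth[of "c s"] cW[OF s] W'W along(2)[OF s] by auto
    ultimately have "range (\<D> F (c s)) = {y. N x0 \<bullet> y = 0}"
      by (intro range_linear_inj_hyperplane smooth_on_linear[OF F' cW[OF s]] dim N0)
    then have "a x0 \<in> range (\<D> F (c s))" using aN by (simp add: inner_commute)
    then obtain u where u: "\<D> F (c s) u = a x0" by auto
    have "k (c s) = F (c s) \<bullet> b (c s)"
      using along(5)[OF s] along(4)[OF s] k0 u0(3)
      by (simp add: Fc[OF s] inner_add_left v_def)
    then have "\<D> F (c s) u \<bullet> a x0 = 0"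
      using key[OF cW[OF s], of u] along(3)[OF s] by simp
    then show False using u a0 by simp
  qed
  have r2: "\<bar>r/2\<bar> < r" "\<bar>-(r/2)\<bar> < r" using r by auto
  show ?thesis
  proof (rule that[of "c (r/2)" "c (-(r/2))" "(r/2) *\<^sub>R v"])
    show "(r/2) *\<^sub>R v \<noteq> 0" using v0 r by simp
    show "F (c (r/2)) = F x0 + (r/2) *\<^sub>R v" "F (c (-(r/2))) = F x0 - (r/2) *\<^sub>R v"
      using Fc[OF r2(1)] Fc[OF r2(2)] by auto
  qed (use cW[OF r2(1)] cW[OF r2(2)] W'W sing[OF r2(1)] sing[OF r2(2)] in auto)
qed

subsection \<open>The singular set\<close>

text \<open>An injective linear map is bounded below by some \<open>B\<close>, and a perturbation of
  norm less than \<open>B\<close> stays injective.\<close>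

lemma open_Collect_inj_frechet_derivative:
  fixes F :: "'a::euclidean_space \<Rightarrow> 'b::euclidean_space"
  assumes F: "smooth_on W F"
  shows "open {x \<in> W. inj (\<D> F x)}"
proof (subst open_subopen, intro ballI)
  fix x assume "x \<in> {x \<in> W. inj (\<D> F x)}"
  then have x: "x \<in> W" and inj: "inj (\<D> F x)" by auto
  obtain B where B: "B > 0" "\<And>u. B * norm u \<le> norm (\<D> F x u)"
    using linear_inj_bounded_below_pos[OF smooth_on_linear[OF F x] inj] by blast
  \<comment> \<open>This sum over a basis bounds the operator norm of the difference of the
    derivatives, and is visibly continuous.\<close>
  define \<phi> where "\<phi> = (\<lambda>y. \<Sum>i\<in>Basis. norm (\<D> F y i - \<D> F x i))"
  have "continuous_on W \<phi>"
    unfolding \<phi>_def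
    by (intro continuous_intros smooth_on_imp_continuous_on smooth_on_frechet_derivative F)
  then have "open (\<phi> -` {..<B} \<inter> W)"
    using continuous_on_open_vimage[OF smooth_on_open[OF F]] open_lessThan by blast
  moreover have "x \<in> \<phi> -` {..<B} \<inter> W" using x B(1) by (simp add: \<phi>_def)
  moreover have "\<phi> -` {..<B} \<inter> W \<subseteq> {x \<in> W. inj (\<D> F x)}"
  proof
    fix y assume "y \<in> \<phi> -` {..<B} \<inter> W"
    then have y: "y \<in> W" and \<phi>: "\<phi> y < B" by auto
    have ly: "linear (\<D> F y)" and lx: "linear (\<D> F x)" using smooth_on_linear[OF F] x y by auto
    have "u = 0" if "\<D> F y u = 0" for u
    proof (rule ccontr)
      assume "u \<noteq> 0"
      have "\<D> F y u - \<D> F x u = (\<Sum>i\<in>Basis. (u \<bullet> i) *\<^sub>R (\<D> F y i - \<D> F x i))"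
        using linear_sum[OF ly, of "\<lambda>i. (u \<bullet> i) *\<^sub>R i" Basis] linear_sum[OF lx, of "\<lambda>i. (u \<bullet> i) *\<^sub>R i" Basis]
        by (simp add: euclidean_representation linear_cmul[OF ly] linear_cmul[OF lx]
            scaleR_diff_right sum_subtractf)
      also have "norm \<dots> \<le> (\<Sum>i\<in>Basis. norm u * norm (\<D> F y i - \<D> F x i))"
        by (intro sum_norm_le) (simp add: mult_right_mono Basis_le_norm)
      also have "\<dots> = norm u * \<phi> y" by (simp add: \<phi>_def sum_distrib_left)
      also have "\<dots> < B * norm u" using \<phi> \<open>u \<noteq> 0\<close> by (simp add: mult.commute)
      finally show False using B(2)[of u] that by simp
    qed
    then show "y \<in> {x \<in> W. inj (\<D> F x)}" using y linear_injective_0[OF ly] by blast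
  qed
  ultimately show "\<exists>T. open T \<and> x \<in> T \<and> T \<subseteq> {x \<in> W. inj (\<D> F x)}" by blast
qed

section \<open>Change of charts and closedness of the singular set\<close>

lemma chart_inv_left: "is_chart c \<Longrightarrow> p \<in> fst c \<Longrightarrow> chart_inv c (snd c p) = p"
  by (simp add: is_chart_def chart_inv_def)

lemma smooth_map_chart:
  "smooth_map A UNIV f \<Longrightarrow> c \<in> A \<Longrightarrow> smooth_on (cdom c) (f \<circ> chart_inv c)"
  unfolding smooth_map_def cdom_def by fastforce

lemma frechet_derivative_compose_cong:
  assumes "open S" "x \<in> S" "\<And>y. y \<in> S \<Longrightarrow> k y = h (g y)"
    and "g differentiable (at x)" "h differentiable (at (g x))"
  shows "\<D> k x = \<D> h (g x) \<circ> \<D> g x"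
proof -
  have "\<D> k x = \<D> (\<lambda>y. h (g y)) x"
    by (rule frechet_derivative_cong_open[OF assms(1-3)])
  also have "\<dots> = (\<lambda>v. \<D> h (g x) (\<D> g x v))"
    by (rule frechet_derivative_eqI[OF has_derivative_compose[OF
            has_derivative_frechet[OF assms(4)] has_derivative_frechet[OF assms(5)]]])
  finally show ?thesis by (simp add: o_def)
qed

text \<open>By the chain rule the two coordinate differentials differ by that of the transition map
  \<open>\<sigma>\<close>, which is injective because \<open>\<tau> \<circ> \<sigma>\<close> is the
  identity.\<close>

lemma inj_cdiff_change_chart:
  assumes A: "smooth_atlas A" and f: "smooth_map A UNIV f" and c: "c1 \<in> A" "c2 \<in> A"
    and p: "p \<in> fst c1" "p \<in> fst c2" and inj: "inj (cdiff c1 f (snd c1 p))"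
  shows "inj (cdiff c2 f (snd c2 p))"
proof -
  have ch: "is_chart c1" "is_chart c2" using A c by (auto simp: smooth_atlas_def)
  define \<sigma> where "\<sigma> = snd c1 \<circ> chart_inv c2"
  define \<tau> where "\<tau> = snd c2 \<circ> chart_inv c1"
  define S where "S = snd c2 ` (fst c2 \<inter> fst c1)"
  have sm: "smooth_on S \<sigma>" and sm': "smooth_on (snd c1 ` (fst c1 \<inter> fst c2)) \<tau>"
    using A c unfolding smooth_atlas_def S_def \<sigma>_def \<tau>_def by blast+
  have x2: "snd c2 p \<in> S" and x1: "snd c1 p \<in> snd c1 ` (fst c1 \<inter> fst c2)"
    using p by (auto simp: S_def)
  have \<sigma>p: "\<sigma> (snd c2 p) = snd c1 p" using p ch by (simp add: \<sigma>_def chart_inv_left)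
  have d\<sigma>: "\<sigma> differentiable (at (snd c2 p))" by (rule smooth_on_imp_differentiable[OF sm x2])
  have d\<tau>: "\<tau> differentiable (at (\<sigma> (snd c2 p)))"
    unfolding \<sigma>p by (rule smooth_on_imp_differentiable[OF sm' x1])
  have df: "(f \<circ> chart_inv c1) differentiable (at (\<sigma> (snd c2 p)))"
    unfolding \<sigma>p using smooth_map_chart[OF f c(1)] p(1)
    by (auto intro!: smooth_on_imp_differentiable simp: cdom_def)
  have f_eq: "\<D> (f \<circ> chart_inv c2) (snd c2 p) = \<D> (f \<circ> chart_inv c1) (snd c1 p) \<circ> \<D> \<sigma> (snd c2 p)"
    unfolding \<sigma>p[symmetric]
    by (rule frechet_derivative_compose_cong[OF smooth_on_open[OF sm] x2 _ d\<sigma> df])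
       (use ch in \<open>auto simp: S_def \<sigma>_def chart_inv_left\<close>)
  have id_eq: "\<D> (\<lambda>x. x) (snd c2 p) = \<D> \<tau> (\<sigma> (snd c2 p)) \<circ> \<D> \<sigma> (snd c2 p)"
    by (rule frechet_derivative_compose_cong[OF smooth_on_open[OF sm] x2 _ d\<sigma> d\<tau>])
       (use ch in \<open>auto simp: S_def \<sigma>_def \<tau>_def chart_inv_left\<close>)
  have "inj (\<D> \<tau> (\<sigma> (snd c2 p)) \<circ> \<D> \<sigma> (snd c2 p))"
    unfolding id_eq[symmetric] by simp
  then have "inj (\<D> \<sigma> (snd c2 p))" by (rule inj_on_imageI2)
  then show ?thesis
    using inj unfolding cdiff_def f_eq by (intro inj_compose)
qed

text \<open>\<open>immersion_at\<close> quantifies over all charts at a point. Regularity is open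
  within a single chart, and the change of charts carries it to the others.\<close>

lemma closed_singular_set:
  fixes A :: "('m::topological_space, 'n::finite) chart set" and f :: "'m \<Rightarrow> 'b::euclidean_space"
  assumes A: "smooth_atlas A" and f: "smooth_map A UNIV f"
  shows "closed (singular_set A f)"
  unfolding closed_def
proof (subst open_subopen, intro ballI)
  fix p assume "p \<in> - singular_set A f"
  then have imm: "immersion_at A f p" by (simp add: singular_set_def)
  obtain c where c: "c \<in> A" "p \<in> fst c" using A unfolding smooth_atlas_def by blast
  have ch: "is_chart c" using A c by (simp add: smooth_atlas_def)
  let ?O = "{x \<in> cdom c. inj (\<D> (f \<circ> chart_inv c) x)}"
  have "open ?O" by (rule open_Collect_inj_frechet_derivative[OF smooth_map_chart[OF f c(1)]])
  then have "open (snd c -` ?O \<inter> fst c)"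
    using ch continuous_on_open_vimage[of "fst c" "snd c"] unfolding is_chart_def by blast
  moreover have "p \<in> snd c -` ?O \<inter> fst c"
    using imm c by (auto simp: immersion_at_def cdiff_def cdom_def)
  moreover have "snd c -` ?O \<inter> fst c \<subseteq> - singular_set A f"
  proof
    fix q assume "q \<in> snd c -` ?O \<inter> fst c"
    then have "q \<in> fst c" "inj (cdiff c f (snd c q))" by (auto simp: cdiff_def)
    then show "q \<in> - singular_set A f"
      using inj_cdiff_change_chart[OF A f c(1)] by (auto simp: singular_set_def immersion_at_def)
  qed
  ultimately show "\<exists>T. open T \<and> p \<in> T \<and> T \<subseteq> - singular_set A f" by blast
qed

lemma continuous_on_smooth_map:
  fixes A :: "('m::t2_space, 'n::finite) chart set" and f :: "'m \<Rightarrow> 'b::real_normed_vector"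
  assumes A: "smooth_atlas A" and f: "smooth_map A UNIV f"
  shows "continuous_on UNIV f"
proof (rule continuous_at_imp_continuous_on, intro ballI)
  fix p
  obtain c where c: "c \<in> A" "p \<in> fst c" using A unfolding smooth_atlas_def by blast
  have ch: "is_chart c" using A c by (simp add: smooth_atlas_def)
  have "continuous_on (fst c) (\<lambda>q. (f \<circ> chart_inv c) (snd c q))"
    using ch by (intro continuous_on_compose2[OF smooth_on_imp_continuous_on[OF smooth_map_chart[OF f c(1)]]])
      (auto simp: is_chart_def cdom_def)
  then have "continuous_on (fst c) f"
    using ch by (simp add: chart_inv_left cong: continuous_on_cong)
  then show "isCont f p"
    using ch c(2) continuous_on_eq_continuous_at unfolding is_chart_def by blast
qed

section \<open>Singular points on the manifold and the maximum argument\<close>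

lemma singular_point_kernel:
  assumes f: "smooth_map A UNIV f" and p: "p \<in> singular_set A f"
  obtains c u where "c \<in> A" "p \<in> fst c" "u \<noteq> 0" "cdiff c f (snd c p) u = 0"
proof -
  obtain c where c: "c \<in> A" "p \<in> fst c" "\<not> inj (cdiff c f (snd c p))"
    using p by (auto simp: singular_set_def immersion_at_def)
  have "linear (cdiff c f (snd c p))"
    unfolding cdiff_def using smooth_on_linear[OF smooth_map_chart[OF f c(1)]] c(2)
    by (auto simp: cdom_def)
  then have "\<exists>u. cdiff c f (snd c p) u = 0 \<and> u \<noteq> 0" using c(3) by (simp add: linear_injective_0)
  then show ?thesis using that c(1,2) by blast
qed

text \<open>The induced metric vanishes on a kernel vector of \<open>df\<close>, so positivity of
  the sum must come from \<open>T\<close>.\<close>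

lemma singular_set_subset_tensor_support:
  assumes f: "smooth_map A UNIV f"
    and T: "riemannian A (\<lambda>c x u v. induced_metric f c x u v + T c x u v)"
  shows "singular_set A f \<subseteq> tensor_support A T"
proof
  fix p assume "p \<in> singular_set A f"
  then obtain c u where c: "c \<in> A" "p \<in> fst c" and u: "u \<noteq> 0" "cdiff c f (snd c p) u = 0"
    by (rule singular_point_kernel[OF f])
  have "induced_metric f c (snd c p) u u + T c (snd c p) u u > 0"
    using T c u(1) unfolding riemannian_def cdom_def by blast
  then have "T c (snd c p) u u \<noteq> 0" by (simp add: induced_metric_def u(2))
  then have "p \<in> {p. \<exists>c\<in>A. p \<in> fst c \<and> (\<exists>u v. T c (snd c p) u v \<noteq> 0)}" using c by blast
  then show "p \<in> tensor_support A T" unfolding tensor_support_def by (rule subsetD[OF closure_subset])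
qed

text \<open>Transfers the local segment to the manifold through one chart in which \<open>df\<close>
  has a kernel at \<open>p\<close>.\<close>

lemma flat_front_singular_segment:
  fixes A :: "('m::topological_space, 'n::finite) chart set" and f :: "'m \<Rightarrow> 'b::euclidean_space"
  assumes dim: "CARD('n) \<ge> 3" "DIM('b) = CARD('n) + 1"
    and A: "smooth_atlas A" and f: "smooth_map A UNIV f" and flat: "flat_front A f"
    and p: "p \<in> singular_set A f"
  obtains q1 q2 v where "q1 \<in> singular_set A f" "q2 \<in> singular_set A f" "v \<noteq> 0"
    "f q1 = f p + v" "f q2 = f p - v"
proof -
  obtain c w where c: "c \<in> A" "p \<in> fst c" and w: "w \<noteq> 0" "cdiff c f (snd c p) w = 0"
    by (rule singular_point_kernel[OF f p])
  have ch: "is_chart c" using A c by (simp add: smooth_atlas_def)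
  obtain U \<nu> where "p \<in> U" and fr: "front_on A f U \<nu>" and fl: "flat_on A U \<nu>"
    using flat unfolding flat_front_def by blast
  have \<nu>: "unit_normal A f U \<nu>"
    and imm: "\<And>q. q \<in> U \<Longrightarrow> immersion_at A (\<lambda>q. (f q, \<nu> q)) q"
    using fr by (auto simp: front_on_def)
  define W where "W = snd c ` (U \<inter> fst c)"
  define F where "F = f \<circ> chart_inv c"
  define N where "N = \<nu> \<circ> chart_inv c"
  have inv: "chart_inv c x \<in> U \<inter> fst c" "snd c (chart_inv c x) = x" if "x \<in> W" for x
    using that ch by (auto simp: W_def chart_inv_left)
  have N: "smooth_on W N"
    using \<nu> c unfolding unit_normal_def smooth_map_def W_def N_def by blast
  have F: "smooth_on W F"
    unfolding F_def by (rule smooth_on_subset[OF smooth_map_chart[OF f c(1)] smooth_on_open[OF N]])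
      (auto simp: W_def cdom_def)
  have unit: "norm (N x) = 1" if "x \<in> W" for x
    using \<nu> inv(1)[OF that] unfolding unit_normal_def N_def by simp
  have orth: "\<D> F x v \<bullet> N x = 0" if "x \<in> W" for x v
  proof -
    have "cdiff c f (snd c (chart_inv c x)) v \<bullet> \<nu> (chart_inv c x) = 0"
      using \<nu> c(1) inv(1)[OF that] unfolding unit_normal_def by blast
    then show ?thesis by (simp add: inv(2)[OF that] cdiff_def F_def N_def)
  qed
  have im: "u = 0" if x: "x \<in> W" and u: "\<D> F x u = 0" "\<D> N x u = 0" for x u
  proof -
    have dFN: "((\<lambda>x. (F x, N x)) has_derivative (\<lambda>u. (\<D> F x u, \<D> N x u))) (at x)"
      by (intro has_derivative_Pair smooth_on_has_derivative[OF _ x] F N)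
    have "cdiff c (\<lambda>q. (f q, \<nu> q)) x = (\<lambda>u. (\<D> F x u, \<D> N x u))"
      using frechet_derivative_eqI[OF dFN] by (simp add: cdiff_def F_def N_def o_def)
    moreover have "inj (cdiff c (\<lambda>q. (f q, \<nu> q)) x)"
      using imm[of "chart_inv c x"] inv(1)[OF x] c(1) inv(2)[OF x] by (auto simp: immersion_at_def)
    ultimately have "inj (\<lambda>u. (\<D> F x u, \<D> N x u))" by simp
    then show ?thesis
      using linear_injective_0[OF has_derivative_linear[OF dFN]] u by (simp add: zero_prod_def)
  qed
  have curv: "curvD N X Y \<xi> x = 0" if "smooth_on W \<xi>" "smooth_on W X" "smooth_on W Y"
    "\<And>x. x \<in> W \<Longrightarrow> \<xi> x \<bullet> N x = 0" "x \<in> W" for \<xi> X Y x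
    using fl c(1) that unfolding flat_on_def W_def N_def o_def by blast
  have x0: "snd c p \<in> W" using c(2) \<open>p \<in> U\<close> by (auto simp: W_def)
  have w0: "\<D> F (snd c p) w = 0" using w(2) by (simp add: F_def cdiff_def)
  have "DIM(real^'n) \<ge> 3" "DIM('b) = DIM(real^'n) + 1" using dim by simp_all
  then obtain x1 x2 v where x: "x1 \<in> W" "x2 \<in> W" and v: "v \<noteq> 0"
    and Fx: "F x1 = F (snd c p) + v" "F x2 = F (snd c p) - v"
    and s: "\<not> inj (\<D> F x1)" "\<not> inj (\<D> F x2)"
    by (rule exists_singular_segment[OF _ _ F N unit orth im
          flat_imp_rank_normal_le_one[OF N unit curv] x0 w(1) w0])
  have "F (snd c p) = f p" using ch c(2) by (simp add: F_def chart_inv_left)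
  \<comment> \<open>Failure of injectivity in a single chart already makes the point
    singular.\<close>
  moreover have sing: "chart_inv c x \<in> singular_set A f" if "x \<in> W" "\<not> inj (\<D> F x)" for x
  proof -
    have "\<not> inj (cdiff c f (snd c (chart_inv c x)))"
      using that(2) by (simp add: inv(2)[OF that(1)] cdiff_def F_def)
    then show ?thesis
      using inv(1)[OF that(1)] c(1) unfolding singular_set_def immersion_at_def by blast
  qed
  ultimately show ?thesis
    using that[OF sing[OF x(1) s(1)] sing[OF x(2) s(2)] v] Fx by (simp add: F_def)
qed

theorem theoremA:
  fixes A :: "('m::{t2_space, second_countable_topology}, 'n::finite) chart set"
    and f :: "'m \<Rightarrow> 'b::euclidean_space"
  assumes "CARD('n) \<ge> 3"
    and "DIM('b) = CARD('n) + 1"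
    and "smooth_atlas A"
    and "connected (UNIV :: 'm set)"
    and "smooth_map A UNIV f"
  shows "\<not> (flat_front A f \<and> complete_front A f \<and> singular_set A f \<noteq> {})"
proof
  assume H: "flat_front A f \<and> complete_front A f \<and> singular_set A f \<noteq> {}"
  then obtain T where "compact (tensor_support A T)"
    and "riemannian A (\<lambda>c x u v. induced_metric f c x u v + T c x u v)"
    unfolding complete_front_def complete_riemannian_def by blast
  then have "compact (singular_set A f)"
    using compact_Int_closed[OF _ closed_singular_set[OF assms(3,5)], of "tensor_support A T"]
      singular_set_subset_tensor_support[OF assms(5), of T] by (simp add: Int_absorb1)
  moreover have "continuous_on (singular_set A f) (\<lambda>q. f q \<bullet> f q)"
    using continuous_on_subset[OF continuous_on_smooth_map[OF assms(3,5)]]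
    by (intro continuous_intros) auto
  ultimately obtain p where p: "p \<in> singular_set A f"
    and max: "\<And>q. q \<in> singular_set A f \<Longrightarrow> f q \<bullet> f q \<le> f p \<bullet> f p"
    using H continuous_attains_sup[of "singular_set A f" "\<lambda>q. f q \<bullet> f q"] by blast
  obtain q1 q2 v where q: "q1 \<in> singular_set A f" "q2 \<in> singular_set A f" "v \<noteq> 0"
    "f q1 = f p + v" "f q2 = f p - v"
    by (rule flat_front_singular_segment[OF assms(1-3,5) conjunct1[OF H] p])
  \<comment> \<open>The parallelogram law: the mean of the two values exceeds the maximum by
    \<open>v \<bullet> v\<close>.\<close>
  have "f q1 \<bullet> f q1 + f q2 \<bullet> f q2 = 2 * (f p \<bullet> f p) + 2 * (v \<bullet> v)"
    by (simp add: q(4,5) inner_add_left inner_add_right inner_diff_left inner_diff_right)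
  moreover have "v \<bullet> v > 0" using q(3) by simp
  ultimately show False using max[OF q(1)] max[OF q(2)] by linarith
qed

end
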